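(* Let $\gamma>1$ and let $\mu,\lambda$ satisfy either ($\mu>1$ and $\lambda\ge0$) or ($\mu=1$ and $0\le\lambda\le2$). Let $\varphi,\psi\in C^1_b(\mathbb{R})$ be such that for some $(\varphi_-,\psi_-)\in\mathbb{R}^2$ $$\lim_{x\to-\infty}(\varphi(x),\psi(x))=(\varphi_-,\psi_-).$$ For $\varepsilon>0$ let $(u,v)$ be the $C^1$ solution, with lifespan $T^*$, of the Cauchy problem $$u_t-v_x=0,\qquad v_t+p(u)_x=-\frac{\lambda}{(1+t)^\mu}v,\qquad (u,v)(0,x)=(1+\varepsilon\varphi(x),\ \varepsilon\psi(x)).$$ There is a positive constant $K=K(\|\varphi\|_{L^\infty(\mathbb{R})},\|\psi\|_{L^\infty(\mathbb{R})})$ (depending also on the fixed parameters $\gamma,\mu,\lambda$) such that if $$\psi_x(x_0)\le -K\quad\text{for some }x_0\in\mathbb{R},$$ then there exist $\varepsilon_0>0$ and a constant $C>0$ independent of $\varepsilon$ such that for all $0<\varepsilon\le\varepsilon_0$ $$T^*\le\begin{cases} C\varepsilon^{-1} & \text{if }\mu>1\text{ and }\lambda\ge0,\\ C\varepsilon^{-\frac{2}{2-\lambda}} & \text{if }\mu=1\text{ and }0\le\lambda<2,\\ e^{C/\varepsilon} & \text{if }\mu=1\text{ and }\lambda=2,\end{cases}$$ and, for some constants $m>0$ and $\delta>0$, $(u(t),v(t))\in X_{m,\delta}$ for all $t\in[0,T^* )$.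
   Context: Pressure: $p(u)=u^{-\gamma}/\gamma$ with $\gamma>1$. $C^1_b(\mathbb{R})$ is the set of bounded $C^1$ functions with bounded first derivative. For $m,\delta>0$, $$X_{m,\delta}=\{(u,v)\in C^1_b(\mathbb{R})\times C^1_b(\mathbb{R}) : \|u\|_{L^\infty}+\|v\|_{L^\infty}\le m,\ u(x)\ge\delta\ \text{for all }x\in\mathbb{R}\}.$$ For initial data in $C^1_b(\mathbb{R})$ with $\inf u(0,\cdot)>0$ (which holds here for $\varepsilon$ sufficiently small) the Cauchy problem ($t\ge0$, $x\in\mathbb{R}$) has a unique local $C^1$ solution. The lifespan is $$T^*=\sup\Big\{T>0 : \text{the }C^1\text{ solution exists on }[0,T)\times\mathbb{R}\text{ and }\sup_{t\in[0,T)}\big(\|(u,v)(t)\|_{L^\infty}+\|(u_t,v_t)(t)\|_{L^\infty}+\|(u_x,v_x)(t)\|_{L^\infty}+\|p'(u(t))\|_{L^\infty}\big)<\infty\Big\}.$$ *)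

theory Defs
  imports "HOL-Analysis.Analysis"
begin

definition pressure :: "real \<Rightarrow> real \<Rightarrow> real" where
  "pressure \<gamma> w = w powr (-\<gamma>) / \<gamma>"

text \<open>All functions whose \<open>L\<^sup>\<infinity>\<close> norm is taken below are continuous, so the essential supremum
  is the supremum. It is taken in \<^typ>\<open>ennreal\<close>: unbounded functions have norm \<open>\<infinity>\<close>.\<close>

definition Linf_norm :: "(real \<Rightarrow> real) \<Rightarrow> ennreal" where
  "Linf_norm f = (SUP x. ennreal \<bar>f x\<bar>)"

definition C1b :: "(real \<Rightarrow> real) set" where
  "C1b = {f. f C1_differentiable_on UNIV \<and> bounded (range f) \<and> bounded (range (deriv f))}"

definition X_space :: "real \<Rightarrow> real \<Rightarrow> ((real \<Rightarrow> real) \<times> (real \<Rightarrow> real)) set" where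
  "X_space m \<delta> = {(u, v). u \<in> C1b \<and> v \<in> C1b \<and>
     Linf_norm u + Linf_norm v \<le> ennreal m \<and> (\<forall>x. u x \<ge> \<delta>)}"

text \<open>Functions of \<open>(t, x)\<close> are curried, time first. The time derivative is one-sided at \<open>t = 0\<close>;
  for \<open>t > 0\<close> the restriction to \<^term>\<open>{0::real..}\<close> has no effect.\<close>

definition dt :: "(real \<Rightarrow> real \<Rightarrow> real) \<Rightarrow> real \<Rightarrow> real \<Rightarrow> real" where
  "dt f t x = vector_derivative (\<lambda>s. f s x) (at t within {0..})"

definition dx :: "(real \<Rightarrow> real \<Rightarrow> real) \<Rightarrow> real \<Rightarrow> real \<Rightarrow> real" where
  "dx f t x = deriv (f t) x"

text \<open>\<open>C\<^sup>1\<close> regularity on \<open>[0, T) \<times> \<real>\<close>: both partial derivatives exist and are jointly continuous.\<close>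

definition C1_on_strip :: "real \<Rightarrow> (real \<Rightarrow> real \<Rightarrow> real) \<Rightarrow> bool" where
  "C1_on_strip T f \<longleftrightarrow>
     (\<forall>t\<in>{0..<T}. \<forall>x. (\<lambda>s. f s x) differentiable (at t within {0..}) \<and>
                       f t differentiable (at x)) \<and>
     continuous_on ({0..<T} \<times> UNIV) (\<lambda>(t, x). dt f t x) \<and>
     continuous_on ({0..<T} \<times> UNIV) (\<lambda>(t, x). dx f t x)"

text \<open>Positivity of \<open>u\<close> is part of being a solution, since the pressure law is only meant
  for \<open>u > 0\<close>, whereas \<open>powr\<close> is total.\<close>

definition C1_solution ::
  "real \<Rightarrow> real \<Rightarrow> real \<Rightarrow> (real \<Rightarrow> real) \<Rightarrow> (real \<Rightarrow> real) \<Rightarrow> real \<Rightarrow>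
   (real \<Rightarrow> real \<Rightarrow> real) \<Rightarrow> (real \<Rightarrow> real \<Rightarrow> real) \<Rightarrow> bool" where
  "C1_solution \<gamma> \<mu> lam u0 v0 T u v \<longleftrightarrow>
     C1_on_strip T u \<and> C1_on_strip T v \<and>
     (\<forall>t\<in>{0..<T}. \<forall>x. u t x > 0) \<and>
     (\<forall>t\<in>{0..<T}. \<forall>x. dt u t x - dx v t x = 0) \<and>
     (\<forall>t\<in>{0..<T}. \<forall>x. dt v t x + dx (\<lambda>s y. pressure \<gamma> (u s y)) t x
                          = - (lam / (1 + t) powr \<mu>) * v t x) \<and>
     (\<forall>x. u 0 x = u0 x) \<and> (\<forall>x. v 0 x = v0 x)"

text \<open>A pair is normed by the sum of the norms of its components.\<close>

definition bounded_C1_solution ::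
  "real \<Rightarrow> real \<Rightarrow> real \<Rightarrow> (real \<Rightarrow> real) \<Rightarrow> (real \<Rightarrow> real) \<Rightarrow> real \<Rightarrow>
   (real \<Rightarrow> real \<Rightarrow> real) \<Rightarrow> (real \<Rightarrow> real \<Rightarrow> real) \<Rightarrow> bool" where
  "bounded_C1_solution \<gamma> \<mu> lam u0 v0 T u v \<longleftrightarrow>
     C1_solution \<gamma> \<mu> lam u0 v0 T u v \<and>
     (SUP t\<in>{0..<T}. (Linf_norm (u t) + Linf_norm (v t))
                    + (Linf_norm (dt u t) + Linf_norm (dt v t))
                    + (Linf_norm (dx u t) + Linf_norm (dx v t))
                    + Linf_norm (\<lambda>x. deriv (pressure \<gamma>) (u t x))) < \<infinity>"

text \<open>The lifespan is extended-real valued, as it may be infinite in general. Solutions in the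
  bounded class are unique, so it does not matter which pair realises a given \<open>T\<close>.\<close>

definition lifespan ::
  "real \<Rightarrow> real \<Rightarrow> real \<Rightarrow> (real \<Rightarrow> real) \<Rightarrow> (real \<Rightarrow> real) \<Rightarrow> ereal" where
  "lifespan \<gamma> \<mu> lam u0 v0 =
     Sup {ereal T |T. T > 0 \<and> (\<exists>u v. bounded_C1_solution \<gamma> \<mu> lam u0 v0 T u v)}"

text \<open>\<open>(u, v)\<close> is the \<open>C\<^sup>1\<close> solution on the whole of \<open>[0, T\<^sup>*) \<times> \<real>\<close>, where \<open>T\<^sup>*\<close> is the
  lifespan; its values at later times are irrelevant.\<close>

definition solution_up_to_lifespan ::
  "real \<Rightarrow> real \<Rightarrow> real \<Rightarrow> (real \<Rightarrow> real) \<Rightarrow> (real \<Rightarrow> real) \<Rightarrow>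
   (real \<Rightarrow> real \<Rightarrow> real) \<Rightarrow> (real \<Rightarrow> real \<Rightarrow> real) \<Rightarrow> bool" where
  "solution_up_to_lifespan \<gamma> \<mu> lam u0 v0 u v \<longleftrightarrow>
     (\<forall>T>0. ereal T < lifespan \<gamma> \<mu> lam u0 v0 \<longrightarrow> bounded_C1_solution \<gamma> \<mu> lam u0 v0 T u v)"

end

theory Submission imports Defs begin

text \<open>With sound speed \<open>c\<close> and \<open>h' = c\<close>, \<open>h 1 = 0\<close>, the Riemann invariants \<open>v \<mp> h u\<close> are transported with
  speeds \<open>\<plusminus>c\<close> up to the source \<open>- a v\<close>, \<open>a = \<lambda> / (1 + t)\<^sup>\<mu>\<close>. A maximum principle keeps both of size \<open>O(\<epsilon>)\<close>,
  hence \<open>u\<close> stays near \<open>1\<close> and \<open>v\<close> near \<open>0\<close> for as long as the solution exists. Along a characteristic the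
  slope of one invariant, weighted by \<open>c\<^sup>1\<^sup>/\<^sup>2\<close>, satisfies \<open>y' = - k y\<^sup>2 - (a / 2) y - (a / 2) (G u)'\<close> with \<open>k\<close>
  bounded below. For \<open>A = exp (\<integral> a / 2)\<close> the function \<open>A y + (a A / 2) G u\<close> solves a Riccati inequality whose
  forcing is integrable and of size \<open>O(\<epsilon>)\<close>; if the initial slope is below \<open>- K \<epsilon>\<close>, it blows up once
  \<open>\<integral> 1 / A\<close> exceeds a multiple of \<open>1 / \<epsilon>\<close>, which gives the three lifespan bounds.\<close>

section \<open>Characteristics and slopes along them\<close>

text \<open>Write R for the slope of the chosen invariant and S for that of the other one. The
  equation for R contains the product R * S, and nothing quantitative is known about S. But S is
  also the rate at which u changes along the characteristic, so a factor that is a power of u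
  changes the coefficient of R * S; \<open>u powr \<theta>\<close> is the power that cancels it and
  leaves only a multiple of R squared. For the same reason the damping term -a * v_x = -(a / 2) * (R
  + S) becomes a multiple of y plus a multiple of the derivative of G u, and G u is O(\<epsilon>) by
  the sup norms of the data alone. Hence K involves no derivative of the data, and it is independent
  of \<epsilon> because the forcing and the initial slope \<epsilon> * \<psi>_x have the same order.

  The parameter ranges serve two demands: the total variation of P = a A / 2 must be finite, and the
  integral of 1 / A must diverge. For \<mu> > 1 the weight A is bounded; for \<mu> = 1 it is (1 + t)
  powr (lam / 2), and both hold because lam is at most 2.\<close>

lemma picard_lindelof_interval:
  fixes f :: "real \<Rightarrow> real \<Rightarrow> real"
  assumes b: "0 \<le> b"
    and cont: "continuous_on ({0..b} \<times> UNIV) (\<lambda>(t, x). f t x)"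
    and lip: "\<And>t x y. t \<in> {0..b} \<Longrightarrow> \<bar>f t x - f t y\<bar> \<le> L * \<bar>x - y\<bar>"
  obtains X where "X 0 = x0"
    "\<And>t. t \<in> {0..b} \<Longrightarrow> (X has_real_derivative f t (X t)) (at t within {0..b})"
proof -
  \<comment> \<open>Weighting the sup norm by \<open>exp (- k * t)\<close> makes the integral
    operator a contraction on all of {0..b} at once. \<open>k \<ge> 2 * L\<close> gives the factor
    1/2; the summand 1 keeps k positive for L = 0.\<close>
  define k where "k = 2 * (\<bar>L\<bar> + 1)"
  have k: "k > 0" "L \<le> k / 2" by (auto simp: k_def)
  \<comment> \<open>Clamping turns functions on {0..b} into bounded continuous functions on the
    line, so that the complete space \<open>bcontfun\<close> can be used.\<close>
  define \<tau> where "\<tau> t = max 0 (min b t)" for t :: real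
  have tau: "\<tau> t \<in> {0..b}" "t \<in> {0..b} \<Longrightarrow> \<tau> t = t" for t using b by (auto simp: \<tau>_def)
  have tau_cont: "continuous_on UNIV \<tau>" unfolding \<tau>_def by (intro continuous_intros)
  define g where "g y s = f s (exp (k * s) * apply_bcontfun y s)" for y :: "real \<Rightarrow>\<^sub>C real" and s
  have g_cont: "continuous_on {0..b} (g y)" for y
  proof -
    have "continuous_on {0..b} (\<lambda>s. (s, exp (k * s) * apply_bcontfun y s))"
      by (intro continuous_intros continuous_on_apply_bcontfun) 
    from continuous_on_compose2[OF cont this] show ?thesis
      unfolding g_def by force
  qed
  define I where "I y t = x0 + integral {0..t} (g y)" for y t
  have I_cont: "continuous_on {0..b} (I y)" for y
    unfolding I_def
    by (intro continuous_intros indefinite_integral_continuous_1 integrable_continuous_interval g_cont)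
  define \<Phi> where "\<Phi> y = Bcontfun (\<lambda>t. exp (- k * \<tau> t) * I y (\<tau> t))" for y
  have \<Phi>: "apply_bcontfun (\<Phi> y) t = exp (- k * \<tau> t) * I y (\<tau> t)" for y t
  proof -
    let ?h = "\<lambda>s. exp (- k * s) * I y s"
    have hc: "continuous_on {0..b} ?h" by (intro continuous_intros I_cont)
    have "continuous_on UNIV (\<lambda>t. ?h (\<tau> t))"
      by (rule continuous_on_compose2[OF hc tau_cont]) (use tau in auto)
    moreover have "bounded (range (\<lambda>t. ?h (\<tau> t)))"
      using compact_imp_bounded[OF compact_continuous_image[OF hc compact_Icc]]
      by (rule bounded_subset) (use tau in auto)
    ultimately show ?thesis unfolding \<Phi>_def by (subst Bcontfun_inverse) (auto simp: bcontfun_def)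
  qed
  have contr: "dist (\<Phi> y) (\<Phi> z) \<le> 1/2 * dist y z" for y z
  proof (rule dist_bound)
    fix t0
    let ?t = "\<tau> t0" and ?d = "dist y z"
    have t: "?t \<in> {0..b}" by (rule tau)
    have int: "g y integrable_on {0..?t}" for y
      by (rule integrable_continuous_interval, rule continuous_on_subset[OF g_cont]) (use t in auto)
    have E: "((\<lambda>s. k/2 * exp (k * s) * ?d) has_integral (exp (k * ?t) * ?d / 2 - exp (k * 0) * ?d / 2)) {0..?t}"
      by (rule fundamental_theorem_of_calculus)
         (use t in \<open>auto intro!: derivative_eq_intros simp: has_real_derivative_iff_has_vector_derivative[symmetric]\<close>)
    have "norm (integral {0..?t} (\<lambda>s. g y s - g z s)) \<le> integral {0..?t} (\<lambda>s. k/2 * exp (k * s) * ?d)"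
    proof (rule integral_norm_bound_integral)
      show "(\<lambda>s. g y s - g z s) integrable_on {0..?t}" by (intro integrable_diff int)
      show "(\<lambda>s. k/2 * exp (k * s) * ?d) integrable_on {0..?t}" using E by blast
      fix s assume s: "s \<in> {0..?t}"
      have "\<bar>g y s - g z s\<bar> \<le> L * \<bar>exp (k * s) * apply_bcontfun y s - exp (k * s) * apply_bcontfun z s\<bar>"
        unfolding g_def by (rule lip) (use s t in auto)
      also have "\<dots> = L * (exp (k * s) * dist (apply_bcontfun y s) (apply_bcontfun z s))"
        by (simp add: dist_real_def abs_mult flip: right_diff_distrib)
      also have "\<dots> \<le> k/2 * (exp (k * s) * ?d)"
        by (intro mult_mono mult_left_mono dist_bounded) (use k in auto)
      finally show "norm (g y s - g z s) \<le> k/2 * exp (k * s) * ?d" by simp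
    qed
    also have "\<dots> \<le> exp (k * ?t) * ?d / 2"
      unfolding integral_unique[OF E] by simp
    finally have *: "\<bar>integral {0..?t} (g y) - integral {0..?t} (g z)\<bar> \<le> exp (k * ?t) * ?d / 2"
      by (simp add: integral_diff int)
    have "dist (apply_bcontfun (\<Phi> y) t0) (apply_bcontfun (\<Phi> z) t0)
        = exp (- k * ?t) * \<bar>integral {0..?t} (g y) - integral {0..?t} (g z)\<bar>"
      unfolding \<Phi> I_def by (simp add: dist_real_def abs_mult flip: right_diff_distrib)
    also have "\<dots> \<le> exp (- k * ?t) * (exp (k * ?t) * ?d / 2)"
      using * by (intro mult_left_mono) auto
    also have "\<dots> = 1/2 * ?d" by (simp add: exp_minus)
    finally show "dist (apply_bcontfun (\<Phi> y) t0) (apply_bcontfun (\<Phi> z) t0) \<le> 1/2 * ?d" .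
  qed
  have "\<exists>!y. \<Phi> y = y" by (rule banach_fix_type[of "1/2"]) (use contr in auto)
  then obtain y where y: "\<Phi> y = y" by blast
  have XI: "exp (k * t) * apply_bcontfun y t = I y t" if "t \<in> {0..b}" for t
    using \<Phi>[of y t] that unfolding y by (simp add: tau exp_minus)
  show ?thesis
  proof (rule that)
    show "I y 0 = x0" by (simp add: I_def)
    fix t assume t: "t \<in> {0..b}"
    have "((\<lambda>t. integral {0..t} (g y)) has_real_derivative g y t) (at t within {0..b})"
      by (rule integral_has_real_derivative[OF g_cont t])
    then have "(I y has_real_derivative g y t) (at t within {0..b})"
      unfolding I_def by (auto intro!: derivative_eq_intros)
    then show "(I y has_real_derivative f t (I y t)) (at t within {0..b})"
      by (simp add: g_def XI[OF t])
  qed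
qed

section \<open>Differentiation along curves\<close>

text \<open>Continuity of one partial derivative suffices for total differentiability, so the time
  derivative enters only at the point itself. Restricting to \<open>S \<times> UNIV\<close> admits
  one-sided time derivatives at the ends of an interval.\<close>

lemma has_derivative_of_partials:
  fixes w :: "real \<Rightarrow> real \<Rightarrow> real"
  assumes wt: "((\<lambda>s. w s x) has_real_derivative wt) (at t within S)"
    and wx: "\<And>s x. s \<in> S \<Longrightarrow> (w s has_real_derivative wx s x) (at x)"
    and cont: "continuous_on (S \<times> UNIV) (\<lambda>(s, x). wx s x)"
    and t: "t \<in> S"
  shows "((\<lambda>(s, x). w s x) has_derivative (\<lambda>(ds, dx). wt * ds + wx t x * dx))
      (at (t, x) within S \<times> UNIV)"
proof -
  have "((\<lambda>(s, x). w s x) has_derivative (\<lambda>(ds, dx). wt * ds + blinfun_scaleR_left (wx t x) dx))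
      (at (t, x) within S \<times> UNIV)"
  proof (rule has_derivative_partialsI[where fy = "\<lambda>s x. blinfun_scaleR_left (wx s x)"])
    show "((\<lambda>s. w s x) has_derivative (*) wt) (at t within S)"
      using wt by (simp add: has_field_derivative_def)
    show "(w s has_derivative blinfun_apply (blinfun_scaleR_left (wx s x))) (at x within UNIV)" if "s \<in> S" for s x
      using wx[OF that, of x]
      by (simp add: has_field_derivative_def mult_commute_abs blinfun_scaleR_left.rep_eq)
    show "continuous (at (t, x) within S \<times> UNIV) (\<lambda>(s, x). blinfun_scaleR_left (wx s x))"
      using cont t unfolding continuous_on_def continuous_within
      by (auto simp: case_prod_unfold intro!: tendsto_intros)
  qed auto
  then show ?thesis by (simp add: blinfun_scaleR_left.rep_eq mult.commute)
qed

lemma continuous_on_of_partials: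
  fixes w :: "real \<Rightarrow> real \<Rightarrow> real"
  assumes wt: "\<And>t x. t \<in> S \<Longrightarrow> ((\<lambda>s. w s x) has_real_derivative wt t x) (at t within S)"
    and wx: "\<And>s x. s \<in> S \<Longrightarrow> (w s has_real_derivative wx s x) (at x)"
    and cont: "continuous_on (S \<times> UNIV) (\<lambda>(s, x). wx s x)"
  shows "continuous_on (S \<times> UNIV) (\<lambda>(s, x). w s x)"
  unfolding continuous_on_eq_continuous_within
  using has_derivative_continuous[OF has_derivative_of_partials[OF wt wx cont]] by blast

lemma has_real_derivative_along_curve:
  fixes w :: "real \<Rightarrow> real \<Rightarrow> real"
  assumes wt: "((\<lambda>s. w s (X t)) has_real_derivative wt) (at t within S)"
    and wx: "\<And>s x. s \<in> S \<Longrightarrow> (w s has_real_derivative wx s x) (at x)"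
    and cont: "continuous_on (S \<times> UNIV) (\<lambda>(s, x). wx s x)"
    and X: "(X has_real_derivative X') (at t within S)"
    and t: "t \<in> S"
  shows "((\<lambda>s. w s (X s)) has_real_derivative wt + wx t (X t) * X') (at t within S)"
proof -
  have "((\<lambda>s. (s, X s)) has_derivative (\<lambda>d. (d, X' * d))) (at t within S)"
    using X by (auto simp: has_field_derivative_def intro!: derivative_eq_intros)
  then have "((\<lambda>(s, x). w s x) \<circ> (\<lambda>s. (s, X s)) has_derivative
     (\<lambda>(ds, dx). wt * ds + wx t (X t) * dx) \<circ> (\<lambda>d. (d, X' * d))) (at t within S)"
    using has_derivative_of_partials[where w = w, OF wt wx cont t]
    by (intro diff_chain_within) (auto elim: has_derivative_subset)
  moreover have "(\<lambda>(ds, dx). wt * ds + wx t (X t) * dx) \<circ> (\<lambda>d. (d, X' * d))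
    = (*) (wt + wx t (X t) * X')"
    by (auto simp: algebra_simps)
  ultimately show ?thesis by (simp add: has_field_derivative_def o_def)
qed

text \<open>The strip is not compact, but the curve is bounded over {0..b}, and uniform continuity
  on a box containing its neighbourhood of width 1 is enough.\<close>

lemma uniformly_close_near_curve:
  fixes g :: "real \<Rightarrow> real \<Rightarrow> real"
  assumes cont: "continuous_on ({0..b} \<times> UNIV) (\<lambda>(t, x). g t x)"
    and X: "continuous_on {0..b} X" and e: "e > 0"
  obtains d where "d > 0"
    "\<And>t z. t \<in> {0..b} \<Longrightarrow> \<bar>z - X t\<bar> < d \<Longrightarrow> \<bar>g t z - g t (X t)\<bar> < e"
proof -
  have "bounded (X ` {0..b})" using compact_continuous_image[OF X compact_Icc] by (rule compact_imp_bounded)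
  then obtain m where m: "\<And>t. t \<in> {0..b} \<Longrightarrow> \<bar>X t\<bar> \<le> m" unfolding bounded_iff by force
  let ?K = "{0..b} \<times> {- m - 1..m + 1}"
  have "uniformly_continuous_on ?K (\<lambda>(t, x). g t x)"
    by (intro compact_uniformly_continuous compact_Times continuous_on_subset[OF cont]) auto
  then obtain d where d: "d > 0"
    "\<And>p q. p \<in> ?K \<Longrightarrow> q \<in> ?K \<Longrightarrow> dist q p < d \<Longrightarrow> dist (case q of (t, x) \<Rightarrow> g t x) (case p of (t, x) \<Rightarrow> g t x) < e"
    using e unfolding uniformly_continuous_on_def by metis
  show ?thesis
  proof (rule that[of "min d 1"])
    fix t z assume t: "t \<in> {0..b}" and z: "\<bar>z - X t\<bar> < min d 1"
    have "\<bar>z\<bar> \<le> m + 1" "\<bar>X t\<bar> \<le> m + 1" using z m[OF t] by linarith+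
    then show "\<bar>g t z - g t (X t)\<bar> < e"
      using d(2)[of "(t, X t)" "(t, z)"] t z by (auto simp: dist_Pair_Pair dist_real_def abs_le_iff)
  qed (use d in auto)
qed

lemma uniform_limit_shift_along_curve:
  fixes g :: "real \<Rightarrow> real \<Rightarrow> real"
  assumes cont: "continuous_on ({0..b} \<times> UNIV) (\<lambda>(t, x). g t x)"
    and X: "continuous_on {0..b} X" and \<eta>: "\<eta> \<longlonglongrightarrow> 0"
  shows "uniform_limit {0..b} (\<lambda>n t. g t (X t + \<eta> n)) (\<lambda>t. g t (X t)) sequentially"
proof (rule uniform_limitI)
  fix e :: real assume "e > 0"
  from uniformly_close_near_curve[OF cont X this] obtain d where d: "d > 0"
    "\<And>t z. t \<in> {0..b} \<Longrightarrow> \<bar>z - X t\<bar> < d \<Longrightarrow> \<bar>g t z - g t (X t)\<bar> < e" by blast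
  have "\<forall>\<^sub>F n in sequentially. \<bar>\<eta> n\<bar> < d" using tendstoD[OF \<eta> d(1)] by simp
  then show "\<forall>\<^sub>F n in sequentially. \<forall>t\<in>{0..b}. dist (g t (X t + \<eta> n)) (g t (X t)) < e"
    by eventually_elim (auto simp: dist_real_def intro!: d(2))
qed

lemma uniform_limit_difference_quotient:
  fixes f :: "real \<Rightarrow> real \<Rightarrow> real"
  assumes f: "\<And>t x. t \<in> {0..b} \<Longrightarrow> (f t has_real_derivative f' t x) (at x)"
    and cont: "continuous_on ({0..b} \<times> UNIV) (\<lambda>(t, x). f' t x)"
    and X: "continuous_on {0..b} X" and \<eta>: "\<eta> \<longlonglongrightarrow> 0" "\<And>n. \<eta> n > 0"
  shows "uniform_limit {0..b} (\<lambda>n t. (f t (X t + \<eta> n) - f t (X t)) / \<eta> n) (\<lambda>t. f' t (X t)) sequentially"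
proof (rule uniform_limitI)
  fix e :: real assume "e > 0"
  from uniformly_close_near_curve[OF cont X this] obtain d where d: "d > 0"
    "\<And>t z. t \<in> {0..b} \<Longrightarrow> \<bar>z - X t\<bar> < d \<Longrightarrow> \<bar>f' t z - f' t (X t)\<bar> < e" by blast
  have "\<forall>\<^sub>F n in sequentially. \<bar>\<eta> n\<bar> < d" using tendstoD[OF \<eta>(1) d(1)] by simp
  then show "\<forall>\<^sub>F n in sequentially. \<forall>t\<in>{0..b}. dist ((f t (X t + \<eta> n) - f t (X t)) / \<eta> n) (f' t (X t)) < e"
  proof eventually_elim
    case (elim n)
    show ?case
    proof
      fix t assume t: "t \<in> {0..b}"
      obtain z where z: "X t < z" "z < X t + \<eta> n"
          "f t (X t + \<eta> n) - f t (X t) = (X t + \<eta> n - X t) * f' t z"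
        using MVT2[of "X t" "X t + \<eta> n" "f t" "f' t"] f[OF t] \<eta>(2) by auto
      have "(f t (X t + \<eta> n) - f t (X t)) / \<eta> n = f' t z" using z(3) \<eta>(2)[of n] by simp
      moreover have "\<bar>f' t z - f' t (X t)\<bar> < e" using z elim by (intro d(2) t) auto
      ultimately show "dist ((f t (X t + \<eta> n) - f t (X t)) / \<eta> n) (f' t (X t)) < e"
        by (simp add: dist_real_def)
    qed
  qed
qed

text \<open>The slope \<open>w\<^sub>x\<close> need not be differentiable, but along a characteristic it is: the difference
  quotients of \<open>w\<close> between the characteristic and its translates have uniformly convergent
  time derivatives.\<close>

lemma slope_along_characteristic:
  fixes w s q :: "real \<Rightarrow> real \<Rightarrow> real"
  assumes w_t: "\<And>t x. t \<in> {0..b} \<Longrightarrow>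
      ((\<lambda>\<tau>. w \<tau> x) has_real_derivative q t x - s t x * w' t x) (at t within {0..b})"
    and w_x: "\<And>t x. t \<in> {0..b} \<Longrightarrow> (w t has_real_derivative w' t x) (at x)"
    and s_x: "\<And>t x. t \<in> {0..b} \<Longrightarrow> (s t has_real_derivative s' t x) (at x)"
    and q_x: "\<And>t x. t \<in> {0..b} \<Longrightarrow> (q t has_real_derivative q' t x) (at x)"
    and w'_cont: "continuous_on ({0..b} \<times> UNIV) (\<lambda>(t, x). w' t x)"
    and s'_cont: "continuous_on ({0..b} \<times> UNIV) (\<lambda>(t, x). s' t x)"
    and q'_cont: "continuous_on ({0..b} \<times> UNIV) (\<lambda>(t, x). q' t x)"
    and X: "\<And>t. t \<in> {0..b} \<Longrightarrow> (X has_real_derivative s t (X t)) (at t within {0..b})"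
    and t: "t \<in> {0..b}"
  shows "((\<lambda>t. w' t (X t)) has_real_derivative q' t (X t) - s' t (X t) * w' t (X t))
           (at t within {0..b})"
proof -
  define \<eta> :: "nat \<Rightarrow> real" where "\<eta> n = inverse (Suc n)" for n
  have \<eta>: "\<eta> \<longlonglongrightarrow> 0" "\<And>n. \<eta> n > 0"
    unfolding \<eta>_def using LIMSEQ_inverse_real_of_nat by auto
  have Xc: "continuous_on {0..b} X"
    by (rule DERIV_continuous_on[where D = "\<lambda>t. s t (X t)"]) (rule X)
  have bdd: "bounded ((\<lambda>t. g t (X t)) ` {0..b})"
    if "continuous_on ({0..b} \<times> UNIV) (\<lambda>(t, x). g t x)" for g :: "real \<Rightarrow> real \<Rightarrow> real"
  proof -
    have "continuous_on {0..b} (\<lambda>t. (t, X t))" by (intro continuous_intros Xc)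
    from continuous_on_compose2[OF that this] have "continuous_on {0..b} (\<lambda>t. g t (X t))" by force
    from compact_continuous_image[OF this compact_Icc] show ?thesis by (rule compact_imp_bounded)
  qed
  define Q where "Q n t = (w t (X t + \<eta> n) - w t (X t)) / \<eta> n" for n t
  \<comment> \<open>The translate moves with the speed at \<open>X t\<close>, not with its own, so
    it is no characteristic: its transport terms leave the speed difference times \<open>w'\<close>
    there. No derivative of \<open>w'\<close> occurs.\<close>
  define Q' where "Q' n t = (q t (X t + \<eta> n) - q t (X t)) / \<eta> n
      - (s t (X t + \<eta> n) - s t (X t)) / \<eta> n * w' t (X t + \<eta> n)" for n t
  have Q: "(Q n has_real_derivative Q' n t) (at t within {0..b})" if t: "t \<in> {0..b}" for n t
  proof -
    have shift: "((\<lambda>t. X t + \<eta> n) has_real_derivative s t (X t)) (at t within {0..b})"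
      using X[OF t] by (auto intro!: derivative_eq_intros)
    have 1: "((\<lambda>t. w t (X t + \<eta> n)) has_real_derivative q t (X t + \<eta> n)
        - s t (X t + \<eta> n) * w' t (X t + \<eta> n) + w' t (X t + \<eta> n) * s t (X t)) (at t within {0..b})"
      by (rule has_real_derivative_along_curve[where X = "\<lambda>t. X t + \<eta> n" and w = w and wx = w',
        OF w_t w_x w'_cont shift t]) (use t in auto)
    have 2: "((\<lambda>t. w t (X t)) has_real_derivative q t (X t)
        - s t (X t) * w' t (X t) + w' t (X t) * s t (X t)) (at t within {0..b})"
      by (rule has_real_derivative_along_curve[where X = X and w = w and wx = w',
        OF w_t w_x w'_cont X t]) (use t in auto)
    show ?thesis unfolding Q_def
      by (rule DERIV_cong[OF DERIV_cdivide[OF DERIV_diff[OF 1 2]]])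
         (use \<eta>(2)[of n] in \<open>simp add: Q'_def field_simps\<close>)
  qed
  have Q': "uniform_limit {0..b} Q' (\<lambda>t. q' t (X t) - s' t (X t) * w' t (X t)) sequentially"
    unfolding Q'_def
    by (intro uniform_limit_minus uniform_lim_mult uniform_limit_difference_quotient
        uniform_limit_shift_along_curve q_x q'_cont s_x s'_cont w'_cont Xc \<eta> bdd)
  have lim: "(\<lambda>n. Q n t) \<longlonglongrightarrow> w' t (X t)" if "t \<in> {0..b}" for t
    unfolding Q_def
    using tendsto_uniform_limitI[OF uniform_limit_difference_quotient[OF w_x w'_cont Xc \<eta>] that] .
  have "\<exists>g. \<forall>t\<in>{0..b}. (\<lambda>n. Q n t) \<longlonglongrightarrow> g t \<and>
      (g has_derivative (*) (q' t (X t) - s' t (X t) * w' t (X t))) (at t within {0..b})"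
  proof (rule has_derivative_sequence[where f' = "\<lambda>n t. (*) (Q' n t)"])
    show "(Q n has_derivative (*) (Q' n t)) (at t within {0..b})" if "t \<in> {0..b}" for n t
      using Q[OF that] by (simp add: has_field_derivative_def)
    fix e :: real assume "e > 0"
    from uniform_limitD[OF Q' this]
    show "\<forall>\<^sub>F n in sequentially. \<forall>t\<in>{0..b}. \<forall>h.
        norm (Q' n t * h - (q' t (X t) - s' t (X t) * w' t (X t)) * h) \<le> e * norm h"
    proof eventually_elim
      case (elim n)
      show ?case
      proof (intro ballI allI)
        fix t h assume "t \<in> {0..b}"
        with elim have "\<bar>Q' n t - (q' t (X t) - s' t (X t) * w' t (X t))\<bar> \<le> e"
          by (auto simp: dist_real_def intro: less_imp_le)
        then have "\<bar>Q' n t - (q' t (X t) - s' t (X t) * w' t (X t))\<bar> * \<bar>h\<bar> \<le> e * \<bar>h\<bar>"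
          by (rule mult_right_mono) auto
        then show "norm (Q' n t * h - (q' t (X t) - s' t (X t) * w' t (X t)) * h) \<le> e * norm h"
          by (simp add: abs_mult flip: left_diff_distrib)
      qed
    qed
  qed (use t lim in auto)
  then obtain g where g: "\<And>t. t \<in> {0..b} \<Longrightarrow> (\<lambda>n. Q n t) \<longlonglongrightarrow> g t"
    "(g has_real_derivative q' t (X t) - s' t (X t) * w' t (X t)) (at t within {0..b})"
    using t unfolding has_field_derivative_def by blast
  have "g t = w' t (X t)" if "t \<in> {0..b}" for t
    using LIMSEQ_unique g(1) lim that by blast
  with g(2) t show ?thesis
    by (auto intro: has_field_derivative_transform_within[OF _ zero_less_one])
qed

text \<open>The logarithmic branch does occur: for G when \<gamma> = 3, and for the weight B when
  lam = 2, where it produces the exponential lifespan bound. Vanishing at 1 makes H u and G u small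
  for u near 1.\<close>

definition powr_primitive :: "real \<Rightarrow> real \<Rightarrow> real" where
  "powr_primitive p w = (if p = -1 then ln w else (w powr (p + 1) - 1) / (p + 1))"

lemma powr_primitive_1 [simp]: "powr_primitive p 1 = 0"
  by (simp add: powr_primitive_def)

lemma has_real_derivative_powr_primitive:
  assumes "w > 0"
  shows "(powr_primitive p has_real_derivative w powr p) (at w)"
proof (cases "p = -1")
  case True
  then show ?thesis using assms unfolding powr_primitive_def
    by (auto intro!: derivative_eq_intros simp: powr_minus_divide)
next
  case False
  then show ?thesis using assms unfolding powr_primitive_def
    by (auto intro!: derivative_eq_intros simp: powr_diff add_eq_0_iff2)
qed

section \<open>Amplitude bound\<close>

text \<open>At the contact point \<open>p - b\<close> is maximal in x, so \<open>p'\<close> equals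
  the slope of the barrier, at most \<delta> in modulus, and transport contributes at most C *
  \<delta>. The damping term has the good sign since p + r = b + r is nonnegative. The barrier rises
  at rate (C + 1) * \<delta>, hence \<open>p - b\<close> is strictly decreasing in time there and
  was positive just before.\<close>

lemma no_first_contact:
  fixes p :: "real \<Rightarrow> real \<Rightarrow> real"
  assumes t0: "0 < t0" "t0 < T"
    and p_t: "((\<lambda>\<tau>. p \<tau> z) has_real_derivative - k * p' - \<alpha> * (p t0 z + r)) (at t0 within {0..<T})"
    and p_x: "(p t0 has_real_derivative p') (at z)"
    and k: "\<bar>k\<bar> \<le> C" and \<alpha>: "\<alpha> \<ge> 0" and \<delta>: "\<delta> > 0"
    and b: "\<And>t x. b t x = M + \<delta> * (1 + sqrt (1 + x\<^sup>2) + (C + 1) * t)"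
    and contact: "p t0 z = b t0 z" and r: "- b t0 z \<le> r"
    and below: "\<And>\<tau> x. 0 \<le> \<tau> \<Longrightarrow> \<tau> \<le> t0 \<Longrightarrow> p \<tau> x \<le> b \<tau> x"
  shows False
proof -
  define q where "q = z / sqrt (1 + z\<^sup>2)"
  have pos: "1 + y\<^sup>2 > 0" for y :: real using zero_le_power2[of y] by linarith
  have q: "\<bar>q\<bar> \<le> 1"
  proof -
    have "\<bar>z\<bar> \<le> sqrt (1 + z\<^sup>2)" by (rule real_le_rsqrt) auto
    then show ?thesis using pos[of z] by (simp add: q_def)
  qed
  have "((\<lambda>x. p t0 x - b t0 x) has_real_derivative p' - \<delta> * q) (at z)"
    unfolding b q_def using p_x pos[of z]
    by (auto intro!: derivative_eq_intros simp: divide_simps)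
  then have "p' - \<delta> * q = 0"
    by (rule DERIV_local_max[where d = 1]) (use below[of t0] contact t0 in auto)
  then have "\<bar>k * p'\<bar> \<le> C * \<delta>"
    using mult_mono[OF k q] k \<delta> by (auto simp: abs_mult mult_ac intro!: mult_left_mono)
  then have neg: "- k * p' - \<alpha> * (p t0 z + r) - \<delta> * (C + 1) < 0"
    using mult_nonneg_nonneg[OF \<alpha>, of "p t0 z + r"] contact r \<delta> by (auto simp: algebra_simps)
  have at: "at t0 within {0..<T} = at t0" by (rule at_within_interior) (use t0 in auto)
  have "((\<lambda>\<tau>. p \<tau> z - b \<tau> z) has_real_derivative - k * p' - \<alpha> * (p t0 z + r) - \<delta> * (C + 1)) (at t0)"
    unfolding b using p_t unfolding at by (auto intro!: derivative_eq_intros)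
  from DERIV_neg_dec_left[OF this neg] obtain d where d: "d > 0"
    "\<And>y. 0 < y \<Longrightarrow> y < d \<Longrightarrow> p t0 z - b t0 z < p (t0 - y) z - b (t0 - y) z" by blast
  define y where "y = min (d / 2) t0"
  have "0 < y" "y < d" "y \<le> t0" using d(1) t0 unfolding y_def by linarith+
  then show False using d(2)[of y] contact below[of "t0 - y" z] by auto
qed

text \<open>The barrier grows linearly in \<open>x\<close>, which replaces the compactness missing on the real line.
  Since both invariants are controlled at once, the coupling term \<open>- \<alpha> (r + s)\<close> has the right sign at
  a first contact.\<close>

lemma riemann_invariants_bound:
  fixes r s :: "real \<Rightarrow> real \<Rightarrow> real"
  assumes r_t: "\<And>t x. t \<in> {0..<T} \<Longrightarrow> ((\<lambda>\<tau>. r \<tau> x) has_real_derivative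
        - c t x * r' t x - \<alpha> t * (r t x + s t x)) (at t within {0..<T})"
    and s_t: "\<And>t x. t \<in> {0..<T} \<Longrightarrow> ((\<lambda>\<tau>. s \<tau> x) has_real_derivative
        c t x * s' t x - \<alpha> t * (r t x + s t x)) (at t within {0..<T})"
    and r_x: "\<And>t x. t \<in> {0..<T} \<Longrightarrow> (r t has_real_derivative r' t x) (at x)"
    and s_x: "\<And>t x. t \<in> {0..<T} \<Longrightarrow> (s t has_real_derivative s' t x) (at x)"
    and r'_cont: "continuous_on ({0..<T} \<times> UNIV) (\<lambda>(t, x). r' t x)"
    and s'_cont: "continuous_on ({0..<T} \<times> UNIV) (\<lambda>(t, x). s' t x)"
    and c: "\<And>t x. t \<in> {0..<T} \<Longrightarrow> \<bar>c t x\<bar> \<le> C"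
    and \<alpha>: "\<And>t. t \<in> {0..<T} \<Longrightarrow> \<alpha> t \<ge> 0"
    and bdd: "\<And>t x. t \<in> {0..<T} \<Longrightarrow> max \<bar>r t x\<bar> \<bar>s t x\<bar> \<le> N"
    and init: "\<And>x. max \<bar>r 0 x\<bar> \<bar>s 0 x\<bar> \<le> M"
    and t: "t \<in> {0..<T}"
  shows "max \<bar>r t x\<bar> \<bar>s t x\<bar> \<le> M"
proof -
  have C: "C \<ge> 0" using c[OF t, of x] by linarith
  have M: "M \<ge> 0" using init[of x] by linarith
  have "max \<bar>r t x\<bar> \<bar>s t x\<bar> < M + \<delta> * (1 + sqrt (1 + x\<^sup>2) + (C + 1) * t)" if \<delta>: "\<delta> > 0" for \<delta>
  proof (rule ccontr)
    assume viol: "\<not> ?thesis"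
    define b where "b t x = M + \<delta> * (1 + sqrt (1 + x\<^sup>2) + (C + 1) * t)" for t x
    define E where "E t x = max \<bar>r t x\<bar> \<bar>s t x\<bar> - b t x" for t x
    have b_ge: "b \<tau> y \<ge> M + \<delta> + \<delta> * \<bar>y\<bar>" if "\<tau> \<ge> 0" for \<tau> y
    proof -
      have "\<bar>y\<bar> \<le> sqrt (1 + y\<^sup>2)" by (rule real_le_rsqrt) auto
      then have "\<delta> * (1 + \<bar>y\<bar>) \<le> \<delta> * (1 + sqrt (1 + y\<^sup>2) + (C + 1) * \<tau>)"
        using C \<delta> that by (intro mult_left_mono) (auto intro: add_increasing2)
      then show ?thesis by (simp add: b_def algebra_simps)
    qed
    have sub: "{0..t} \<times> UNIV \<subseteq> {0..<T} \<times> UNIV" using t by auto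
    have rc: "continuous_on ({0..t} \<times> UNIV) (\<lambda>(t, x). r t x)"
      by (rule continuous_on_subset[OF continuous_on_of_partials[where w = r, OF r_t r_x r'_cont] sub])
    have sc: "continuous_on ({0..t} \<times> UNIV) (\<lambda>(t, x). s t x)"
      by (rule continuous_on_subset[OF continuous_on_of_partials[where w = s, OF s_t s_x s'_cont] sub])
    have Ec: "continuous_on ({0..t} \<times> UNIV) (\<lambda>(t, x). E t x)"
      using rc sc unfolding E_def b_def case_prod_unfold by (intro continuous_intros)
    \<comment> \<open>Where the barrier is reached, \<delta> * |y| is at most the a priori bound N;
      this confines all contacts to a compact box, so a first contact time exists.\<close>
    define K where "K = {0..t} \<times> {- (N / \<delta>)..N / \<delta>}"
    define V where "V = K \<inter> (\<lambda>(t, x). E t x) -` {0..}"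
    have "compact K" unfolding K_def by (intro compact_Times) auto
    have V_compact: "compact V"
    proof -
      have "closed V" unfolding V_def
        by (rule continuous_closed_preimage[OF continuous_on_subset[OF Ec]])
           (use \<open>compact K\<close> in \<open>auto simp: K_def compact_imp_closed\<close>)
      then have "compact (K \<inter> V)" using \<open>compact K\<close> by (rule compact_Int_closed[rotated])
      moreover have "K \<inter> V = V" by (auto simp: V_def)
      ultimately show ?thesis by simp
    qed
    have in_V: "(\<tau>, y) \<in> V" if "\<tau> \<in> {0..t}" "E \<tau> y \<ge> 0" for \<tau> y
    proof -
      have "\<delta> * \<bar>y\<bar> \<le> N"
        using that b_ge[of \<tau> y] bdd[of \<tau> y] t M \<delta> by (auto simp: E_def)
      then have "\<bar>y\<bar> \<le> N / \<delta>" using \<delta> by (simp add: field_simps)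
      then show ?thesis using that by (auto simp: V_def K_def abs_le_iff)
    qed
    have "(t, x) \<in> V" by (rule in_V) (use viol t in \<open>auto simp: E_def b_def\<close>)
    then obtain z where "z \<in> V" and z: "\<And>z'. z' \<in> V \<Longrightarrow> fst z \<le> fst z'"
      using continuous_attains_inf[OF V_compact, of fst] continuous_on_fst[OF continuous_on_id] by fast
    moreover obtain t0 x0 where "z = (t0, x0)" by force
    ultimately have V0: "(t0, x0) \<in> V" and first: "\<And>\<tau> y. (\<tau>, y) \<in> V \<Longrightarrow> t0 \<le> \<tau>" by force+
    from V0 have t0: "0 \<le> t0" "t0 \<le> t" and E0: "E t0 x0 \<ge> 0" by (auto simp: V_def K_def)
    have t0T: "t0 \<in> {0..<T}" using t0 t by auto
    have "\<delta> * \<bar>x0\<bar> \<ge> 0" using \<delta> by simp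
    then have "E 0 x0 < 0" using init[of x0] b_ge[of 0 x0] \<delta> unfolding E_def by linarith
    with E0 t0 have pos: "t0 > 0" by (cases "t0 = 0") auto
    have before: "E \<tau> y \<le> 0" if "\<tau> \<in> {0..<t0}" for \<tau> y
      using in_V[of \<tau> y] first[of \<tau> y] that t0 by force
    have at_t0: "E t0 y \<le> 0" for y
    proof -
      have "continuous_on {0..t} (\<lambda>\<tau>. (\<tau>, y))" by (intro continuous_intros)
      from continuous_on_compose2[OF Ec this] have "continuous_on {0..t} (\<lambda>\<tau>. E \<tau> y)" by force
      then have "((\<lambda>\<tau>. E \<tau> y) \<longlongrightarrow> E t0 y) (at t0 within {0..t})"
        using t0 by (auto simp: continuous_on_def)
      then have "((\<lambda>\<tau>. E \<tau> y) \<longlongrightarrow> E t0 y) (at t0 within {0..t0})"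
        by (rule tendsto_within_subset) (use t0 in auto)
      then have lim: "((\<lambda>\<tau>. E \<tau> y) \<longlongrightarrow> E t0 y) (at_left t0)"
        using pos by (simp add: at_within_Icc_at_left)
      have "\<forall>\<^sub>F \<tau> in at_left t0. E \<tau> y \<le> 0"
        unfolding eventually_at_left_field using before pos by force
      then show ?thesis by (rule tendsto_upperbound[OF lim]) simp
    qed
    have below: "max \<bar>r \<tau> y\<bar> \<bar>s \<tau> y\<bar> \<le> b \<tau> y" if "0 \<le> \<tau>" "\<tau> \<le> t0" for \<tau> y
      using before[of \<tau> y] at_t0[of y] that by (cases "\<tau> = t0") (auto simp: E_def)
    note contact_rule = no_first_contact[OF pos, where z = x0 and b = b and T = T and C = C, OF _ _ _ _ \<alpha>[OF t0T] \<delta> b_def]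
    have t0_T: "t0 < T" using t0T by simp
    have bnd: "r \<tau> y \<le> b \<tau> y" "- r \<tau> y \<le> b \<tau> y" "s \<tau> y \<le> b \<tau> y" "- s \<tau> y \<le> b \<tau> y"
      if "0 \<le> \<tau>" "\<tau> \<le> t0" for \<tau> y
      using below[OF that, of y] by auto
    have bnd0: "- b t0 x0 \<le> r t0 x0" "r t0 x0 \<le> b t0 x0" "- b t0 x0 \<le> s t0 x0" "s t0 x0 \<le> b t0 x0"
      using below[OF t0(1) order.refl, of x0] by auto
    \<comment> \<open>Negating both invariants preserves the system, and exchanging them reverses
      the speed; one contact rule therefore serves all four cases.\<close>
    consider "r t0 x0 = b t0 x0" | "r t0 x0 = - b t0 x0" | "s t0 x0 = b t0 x0" | "s t0 x0 = - b t0 x0"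
      using bnd[of t0 x0] E0 t0 unfolding E_def by (auto simp: max_def abs_if split: if_splits)
    then show False
    proof cases
      case 1
      show False
        by (rule contact_rule[where p = r and r = "s t0 x0" and k = "c t0 x0" and p' = "r' t0 x0"])
           (use 1 r_t[OF t0T, of x0] r_x[OF t0T] c[OF t0T] t0 t0_T bnd0 bnd in auto)
    next
      case 2
      show False
        by (rule contact_rule[where p = "\<lambda>t x. - r t x" and r = "- s t0 x0" and k = "c t0 x0" and p' = "- r' t0 x0"])
           (use 2 DERIV_minus[OF r_t[OF t0T, of x0]] DERIV_minus[OF r_x[OF t0T]] c[OF t0T] t0 t0_T bnd0 bnd
            in \<open>auto simp: algebra_simps\<close>)
    next
      case 3
      show False
        by (rule contact_rule[where p = s and r = "r t0 x0" and k = "- c t0 x0" and p' = "s' t0 x0"])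
           (use 3 s_t[OF t0T, of x0] s_x[OF t0T] c[OF t0T] t0 t0_T bnd0 bnd
            in \<open>auto simp: add.commute\<close>)
    next
      case 4
      show False
        by (rule contact_rule[where p = "\<lambda>t x. - s t x" and r = "- r t0 x0" and k = "- c t0 x0" and p' = "- s' t0 x0"])
           (use 4 DERIV_minus[OF s_t[OF t0T, of x0]] DERIV_minus[OF s_x[OF t0T]] c[OF t0T] t0 t0_T bnd0 bnd
            in \<open>auto simp: algebra_simps\<close>)
    qed
  qed
  note strict = this
  show ?thesis
  proof (rule field_le_epsilon)
    fix e :: real assume e: "e > 0"
    \<comment> \<open>With \<delta> = e / ?L the barrier takes the value M + e at the given
      point.\<close>
    let ?L = "1 + sqrt (1 + x\<^sup>2) + (C + 1) * t"
    have L: "?L > 0" using C t by (intro add_pos_nonneg) auto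
    show "max \<bar>r t x\<bar> \<bar>s t x\<bar> \<le> M + e"
      using strict[of "e / ?L"] e L by (auto intro: less_imp_le)
  qed
qed

section \<open>Blow-up of the Riccati inequality\<close>

lemma nonincreasing_within:
  fixes f :: "real \<Rightarrow> real"
  assumes f: "\<And>t. t \<in> {0..b} \<Longrightarrow> (f has_real_derivative f' t) (at t within {0..b})"
    and neg: "\<And>t. t \<in> {0..b} \<Longrightarrow> f' t \<le> 0" and t: "t \<in> {0..b}"
  shows "f t \<le> f 0"
proof (rule DERIV_nonpos_imp_decreasing_open[where f = f and a = 0 and b = t])
  have "continuous_on {0..b} f" by (rule DERIV_continuous_on[where D = f']) (rule f)
  then show "continuous_on {0..t} f" by (rule continuous_on_subset) (use t in auto)
  fix x assume x: "0 < x" "x < t"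
  then have "at x within {0..b} = at x" using t by (intro at_within_interior) auto
  then show "\<exists>y. (f has_real_derivative y) (at x) \<and> y \<le> 0"
    using f[of x] neg[of x] x t by auto
qed (use t in auto)

text \<open>\<open>A\<close> is the integrating factor exp (\<integral> a / 2) and \<open>P\<close>
  its derivative. \<open>F\<close> dominates the accumulated variation of \<open>P\<close> and is
  bounded by \<open>F1\<close>; \<open>B\<close> lies below the integral of 1 / A. Inequalities for
  \<open>F\<close> and \<open>B\<close> leave room for explicit formulas.\<close>

locale damping_weights =
  fixes a A P P' F F' B B' :: "real \<Rightarrow> real" and P1 F1 :: real
  assumes A_0: "A 0 = 1" and A_pos: "t \<ge> 0 \<Longrightarrow> A t > 0"
    and A_deriv: "t \<ge> 0 \<Longrightarrow> (A has_real_derivative P t) (at t)"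
    and P_eq: "t \<ge> 0 \<Longrightarrow> P t = a t / 2 * A t"
    and P_deriv: "t \<ge> 0 \<Longrightarrow> (P has_real_derivative P' t) (at t)"
    and P_bound: "t \<ge> 0 \<Longrightarrow> \<bar>P t\<bar> \<le> P1"
    and F_0: "F 0 = 0" and F_deriv: "t \<ge> 0 \<Longrightarrow> (F has_real_derivative F' t) (at t)"
    and F_dominates: "t \<ge> 0 \<Longrightarrow> \<bar>P' t\<bar> \<le> F' t"
    and F_bound: "t \<ge> 0 \<Longrightarrow> F t \<le> F1"
    and B_0: "B 0 = 0" and B_deriv: "t \<ge> 0 \<Longrightarrow> (B has_real_derivative B' t) (at t)"
    and B_le: "t \<ge> 0 \<Longrightarrow> B' t \<le> 1 / A t"
begin

text \<open>The term \<open>- (a / 2) G'\<close> is absorbed by passing to \<open>A y + P G\<close>, whose derivative involves \<open>G\<close> but not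
  \<open>G'\<close>.\<close>

lemma riccati_blowup:
  assumes b: "b \<ge> 0"
    and y: "\<And>t. t \<in> {0..b} \<Longrightarrow>
      (y has_real_derivative - k t * (y t)\<^sup>2 - a t / 2 * y t - a t / 2 * G' t) (at t within {0..b})"
    and G: "\<And>t. t \<in> {0..b} \<Longrightarrow> (G has_real_derivative G' t) (at t within {0..b})"
    and G_bound: "\<And>t. t \<in> {0..b} \<Longrightarrow> \<bar>G t\<bar> \<le> g"
    and k: "\<And>t. t \<in> {0..b} \<Longrightarrow> k0 \<le> k t" and k0: "k0 > 0"
    and \<epsilon>: "\<epsilon> > 0" and y0: "y 0 \<le> - \<epsilon> - 2 * g * (F1 + P1) - P1 * g"
  shows "B b \<le> 4 / (k0 * \<epsilon>)"
proof -
  have g: "g \<ge> 0" using G_bound[of 0] b by auto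
  have F1: "F1 \<ge> 0" using F_bound[of 0] F_0 by simp
  have P1: "P1 \<ge> 0" using P_bound[of 0] by simp
  \<comment> \<open>Subtracting g * F cancels the remaining forcing P' * G, so that W is
    nonincreasing.\<close>
  define W where "W t = A t * y t + P t * G t - g * F t" for t
  define W' where "W' t = - k t * A t * (y t)\<^sup>2 + P' t * G t - g * F' t" for t
  have W: "(W has_real_derivative W' t) (at t within {0..b})" if t: "t \<in> {0..b}" for t
  proof -
    have t0: "t \<ge> 0" using t by simp
    show ?thesis
      unfolding W_def
      by (rule DERIV_cong[OF DERIV_diff[OF DERIV_add[OF
            DERIV_mult[OF has_field_derivative_at_within[OF A_deriv[OF t0]] y[OF t]]
            DERIV_mult[OF has_field_derivative_at_within[OF P_deriv[OF t0]] G[OF t]]]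
            DERIV_cmult[OF has_field_derivative_at_within[OF F_deriv[OF t0]]]]])
         (simp add: W'_def P_eq[OF t0] algebra_simps power2_eq_square)
  qed
  have W'_le: "W' t \<le> - k0 * (A t * (y t)\<^sup>2)" if t: "t \<in> {0..b}" for t
  proof -
    have t0: "t \<ge> 0" using t by simp
    have "\<bar>P' t * G t\<bar> \<le> F' t * g"
      unfolding abs_mult using F_dominates[OF t0] by (intro mult_mono G_bound t) auto
    moreover have "k0 * (A t * (y t)\<^sup>2) \<le> k t * (A t * (y t)\<^sup>2)"
      using A_pos[OF t0] by (intro mult_right_mono k t) auto
    ultimately show ?thesis by (simp add: W'_def algebra_simps)
  qed
  have W'_neg: "W' t \<le> 0" if t: "t \<in> {0..b}" for t
    using W'_le[OF t] A_pos[of t] t k0 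
    by (smt (verit) atLeastAtMost_iff mult_nonneg_nonneg mult_minus_left zero_le_power2)
  \<comment> \<open>The summand P1 * g in the assumption on \<open>y 0\<close> pays for the term P *
    G at time 0.\<close>
  have W0: "W 0 \<le> - \<epsilon> - 2 * g * (F1 + P1)"
  proof -
    have "\<bar>P 0 * G 0\<bar> \<le> P1 * g"
      unfolding abs_mult using b P1 by (intro mult_mono G_bound P_bound) auto
    then show ?thesis using y0 by (simp add: W_def A_0 F_0)
  qed
  have W_le: "W t \<le> - \<epsilon> - 2 * g * (F1 + P1)" if "t \<in> {0..b}" for t
    using nonincreasing_within[OF W W'_neg that] W0 by linarith
  have W_neg: "W t < 0" if t: "t \<in> {0..b}" for t
  proof -
    have "0 \<le> 2 * g * (F1 + P1)" using g F1 P1 by simp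
    then show ?thesis using W_le[OF t] \<epsilon> by linarith
  qed
  have Riccati: "k0 / 4 * B' t \<le> - W' t / (W t)\<^sup>2" if t: "t \<in> {0..b}" for t
  proof -
    have t0: "t \<ge> 0" using t by simp
    have "\<bar>P t * G t\<bar> \<le> P1 * g"
      unfolding abs_mult using P1 by (intro mult_mono G_bound P_bound t t0) auto
    moreover have "g * F t \<le> g * F1" using g by (intro mult_left_mono F_bound t0)
    ultimately have "A t * y t \<le> W t + g * (F1 + P1)" by (simp add: W_def algebra_simps)
    \<comment> \<open>The reserve 2 * g * (F1 + P1) keeps the corrections below half of |W|.
      Squaring this half produces the 4 in the final bound.\<close>
    also have "\<dots> \<le> W t / 2" using W_le[OF t] \<epsilon> by (simp add: algebra_simps)
    finally have "- W t / 2 \<le> - (A t * y t)" by simp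
    from power_mono[OF this, of 2] have "(W t)\<^sup>2 / 4 \<le> (A t * y t)\<^sup>2"
      using W_neg[OF t] by (simp add: power_divide)
    then have "(W t)\<^sup>2 / (4 * A t) \<le> A t * (y t)\<^sup>2"
      using A_pos[OF t0] by (simp add: field_simps power2_eq_square)
    then have "k0 * ((W t)\<^sup>2 / (4 * A t)) \<le> k0 * (A t * (y t)\<^sup>2)"
      using k0 by (intro mult_left_mono) auto
    also have "\<dots> \<le> - W' t" using W'_le[OF t] by simp
    finally have "k0 / (4 * A t) \<le> - W' t / (W t)\<^sup>2"
      using W_neg[OF t] A_pos[OF t0] by (simp add: field_simps)
    moreover have "k0 / 4 * B' t \<le> k0 / 4 * (1 / A t)"
      using k0 by (intro mult_left_mono B_le t0) auto
    moreover have "k0 / 4 * (1 / A t) = k0 / (4 * A t)" by simp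
    ultimately show ?thesis by linarith
  qed
  \<comment> \<open>Integrated Riccati inequality: -1 / W stays positive, starts below 1 /
    \<epsilon>, and loses at least k0 / 4 times the increase of B.\<close>
  have "k0 / 4 * B b - 1 / W b \<le> k0 / 4 * B 0 - 1 / W 0"
  proof (rule nonincreasing_within[of b "\<lambda>t. k0 / 4 * B t - 1 / W t" "\<lambda>t. k0 / 4 * B' t + W' t / (W t)\<^sup>2"])
    fix t assume t: "t \<in> {0..b}"
    then have B: "(B has_real_derivative B' t) (at t within {0..b})"
      using B_deriv[of t] has_field_derivative_at_within by auto
    show "((\<lambda>t. k0 / 4 * B t - 1 / W t) has_real_derivative k0 / 4 * B' t + W' t / (W t)\<^sup>2) (at t within {0..b})"
      using B W[OF t] W_neg[OF t]
      by (auto intro!: derivative_eq_intros simp: power2_eq_square)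
    show "k0 / 4 * B' t + W' t / (W t)\<^sup>2 \<le> 0" using Riccati[OF t] by simp
  qed (use b in auto)
  moreover have "1 / W b < 0" using W_neg[of b] b by simp
  moreover have "- 1 / W 0 \<le> 1 / \<epsilon>"
  proof -
    have "0 \<le> 2 * g * (F1 + P1)" using g F1 P1 by simp
    then have "\<epsilon> \<le> - W 0" using W0 by linarith
    then have "1 / (- W 0) \<le> 1 / \<epsilon>" using \<epsilon> by (intro frac_le) auto
    then show ?thesis by simp
  qed
  ultimately have "k0 / 4 * B b \<le> 1 / \<epsilon>" unfolding B_0 by linarith
  then show ?thesis using k0 \<epsilon> by (simp add: field_simps)
qed

end

section \<open>The damped p-system\<close>

lemma powr_primitive_mono:
  assumes "0 < w" "w \<le> z"
  shows "powr_primitive p w \<le> powr_primitive p z"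
proof (rule DERIV_nonneg_imp_nondecreasing[OF assms(2)])
  fix x assume "w \<le> x"
  then show "\<exists>y. (powr_primitive p has_real_derivative y) (at x) \<and> 0 \<le> y"
    using has_real_derivative_powr_primitive[of x p] assms(1) by (intro exI[of _ "x powr p"]) auto
qed

text \<open>The \<open>p\<close>-system with \<open>\<theta> = - (\<gamma> + 1) / 4\<close>, so that the sound speed is \<open>u powr (2 * \<theta>)\<close>. The Riemann
  invariants are \<open>v - \<sigma> * powr_primitive (2 * \<theta>) u\<close>, transported with speed \<open>\<sigma> * u powr (2 * \<theta>)\<close>,
  where \<open>\<sigma> = \<plusminus>1\<close>.\<close>

locale damped_p_system =
  fixes \<theta> T l N :: real and a :: "real \<Rightarrow> real" and u v u\<^sub>x v\<^sub>x :: "real \<Rightarrow> real \<Rightarrow> real"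
  assumes theta: "\<theta> < 0" and l: "0 < l"
    and a_nonneg: "t \<in> {0..<T} \<Longrightarrow> 0 \<le> a t" and a_cont: "continuous_on {0..<T} a"
    and u_t: "t \<in> {0..<T} \<Longrightarrow> ((\<lambda>\<tau>. u \<tau> x) has_real_derivative v\<^sub>x t x) (at t within {0..<T})"
    and v_t: "t \<in> {0..<T} \<Longrightarrow> ((\<lambda>\<tau>. v \<tau> x) has_real_derivative
        u t x powr (4 * \<theta>) * u\<^sub>x t x - a t * v t x) (at t within {0..<T})"
    and u_x: "t \<in> {0..<T} \<Longrightarrow> (u t has_real_derivative u\<^sub>x t x) (at x)"
    and v_x: "t \<in> {0..<T} \<Longrightarrow> (v t has_real_derivative v\<^sub>x t x) (at x)"
    and u\<^sub>x_cont: "continuous_on ({0..<T} \<times> UNIV) (\<lambda>(t, x). u\<^sub>x t x)"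
    and v\<^sub>x_cont: "continuous_on ({0..<T} \<times> UNIV) (\<lambda>(t, x). v\<^sub>x t x)"
    and u_ge: "t \<in> {0..<T} \<Longrightarrow> l \<le> u t x" and u_le: "t \<in> {0..<T} \<Longrightarrow> u t x \<le> N"
    and v_bdd: "t \<in> {0..<T} \<Longrightarrow> \<bar>v t x\<bar> \<le> N"
    and u\<^sub>x_bdd: "t \<in> {0..<T} \<Longrightarrow> \<bar>u\<^sub>x t x\<bar> \<le> N"
    and v\<^sub>x_bdd: "t \<in> {0..<T} \<Longrightarrow> \<bar>v\<^sub>x t x\<bar> \<le> N"
begin

abbreviation H :: "real \<Rightarrow> real" where "H \<equiv> powr_primitive (2 * \<theta>)"
abbreviation G :: "real \<Rightarrow> real" where "G \<equiv> powr_primitive \<theta>"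

lemma u_pos: "t \<in> {0..<T} \<Longrightarrow> 0 < u t x"
  using l u_ge[of t x] by linarith

lemma u_cont: "continuous_on ({0..<T} \<times> UNIV) (\<lambda>(t, x). u t x)"
  by (rule continuous_on_of_partials[where w = u, OF u_t u_x u\<^sub>x_cont])

lemma u_powr_cont: "continuous_on ({0..<T} \<times> UNIV) (\<lambda>(t, x). u t x powr p)"
proof -
  have "continuous_on ({0..<T} \<times> UNIV) (\<lambda>z. (case z of (t, x) \<Rightarrow> u t x) powr p)"
    by (intro continuous_on_powr' u_cont continuous_on_const)
       (use u_pos in \<open>auto simp: less_imp_le less_imp_neq[symmetric]\<close>)
  then show ?thesis by (simp add: case_prod_unfold)
qed

lemma H_t: "t \<in> {0..<T} \<Longrightarrow>
    ((\<lambda>\<tau>. H (u \<tau> x)) has_real_derivative u t x powr (2 * \<theta>) * v\<^sub>x t x) (at t within {0..<T})"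
  by (rule DERIV_chain2[OF has_real_derivative_powr_primitive[OF u_pos] u_t])

lemma H_x: "t \<in> {0..<T} \<Longrightarrow>
    ((\<lambda>x. H (u t x)) has_real_derivative u t x powr (2 * \<theta>) * u\<^sub>x t x) (at x)"
  by (rule DERIV_chain2[OF has_real_derivative_powr_primitive[OF u_pos] u_x])

lemma powr_square: "w powr (4 * \<theta>) = w powr (2 * \<theta>) * w powr (2 * \<theta>)"
  by (simp flip: powr_add)

lemma invariant_t:
  assumes "t \<in> {0..<T}" "\<sigma> * \<sigma> = 1"
  shows "((\<lambda>\<tau>. v \<tau> x - \<sigma> * H (u \<tau> x)) has_real_derivative
      - a t * v t x - \<sigma> * u t x powr (2 * \<theta>) * (v\<^sub>x t x - \<sigma> * u t x powr (2 * \<theta>) * u\<^sub>x t x))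
      (at t within {0..<T})"
proof (rule DERIV_cong[OF DERIV_diff[OF v_t DERIV_cmult[OF H_t]]])
  have "\<sigma> * c * (\<sigma> * c * d) = c * c * d" for c d :: real
    using assms(2) by algebra
  then show "u t x powr (4 * \<theta>) * u\<^sub>x t x - a t * v t x - \<sigma> * (u t x powr (2 * \<theta>) * v\<^sub>x t x) =
    - a t * v t x - \<sigma> * u t x powr (2 * \<theta>) * (v\<^sub>x t x - \<sigma> * u t x powr (2 * \<theta>) * u\<^sub>x t x)"
    by (simp add: powr_square right_diff_distrib)
qed fact+

lemma invariant_x:
  assumes "t \<in> {0..<T}"
  shows "((\<lambda>x. v t x - \<sigma> * H (u t x)) has_real_derivative
      v\<^sub>x t x - \<sigma> * u t x powr (2 * \<theta>) * u\<^sub>x t x) (at x)"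
  by (rule DERIV_cong[OF DERIV_diff[OF v_x DERIV_cmult[OF H_x]]]) (use assms in auto)

lemma invariant_x_cont:
  "continuous_on ({0..<T} \<times> UNIV) (\<lambda>(t, x). v\<^sub>x t x - \<sigma> * u t x powr (2 * \<theta>) * u\<^sub>x t x)"
  using u\<^sub>x_cont v\<^sub>x_cont u_powr_cont[of "2 * \<theta>"] unfolding case_prod_unfold
  by (intro continuous_on_diff continuous_on_mult continuous_on_const)

text \<open>The larger modulus of the two invariants is exactly |v| + |H u|. The constants l and N
  serve only to start the maximum principle and do not enter the bound, which is therefore uniform
  in T.\<close>

lemma amplitude_bound:
  assumes init: "\<And>x. \<bar>v 0 x\<bar> + \<bar>H (u 0 x)\<bar> \<le> M" and t: "t \<in> {0..<T}"
  shows "\<bar>v t x\<bar> + \<bar>H (u t x)\<bar> \<le> M"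
proof -
  have max_eq: "max \<bar>p - 1 * q\<bar> \<bar>p - (- 1) * q\<bar> = \<bar>p\<bar> + \<bar>q\<bar>" for p q :: real
    by auto
  have "max \<bar>v t x - 1 * H (u t x)\<bar> \<bar>v t x - (- 1) * H (u t x)\<bar> \<le> M"
  proof (rule riemann_invariants_bound[where
        r = "\<lambda>t x. v t x - 1 * H (u t x)" and s = "\<lambda>t x. v t x - (- 1) * H (u t x)" and
        r' = "\<lambda>t x. v\<^sub>x t x - 1 * u t x powr (2 * \<theta>) * u\<^sub>x t x" and
        s' = "\<lambda>t x. v\<^sub>x t x - (- 1) * u t x powr (2 * \<theta>) * u\<^sub>x t x" and
        c = "\<lambda>t x. u t x powr (2 * \<theta>)" and \<alpha> = "\<lambda>t. a t / 2" and
        N = "N + \<bar>H l\<bar> + \<bar>H N\<bar>" and C = "l powr (2 * \<theta>)" and T = T and t = t and x = x])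
    fix t x assume t: "t \<in> {0..<T}"
    show "((\<lambda>\<tau>. v \<tau> x - 1 * H (u \<tau> x)) has_real_derivative
        - (u t x powr (2 * \<theta>)) * (v\<^sub>x t x - 1 * u t x powr (2 * \<theta>) * u\<^sub>x t x)
        - a t / 2 * (v t x - 1 * H (u t x) + (v t x - - 1 * H (u t x)))) (at t within {0..<T})"
      by (rule DERIV_cong[OF invariant_t[OF t]]) (auto simp: algebra_simps)
    show "((\<lambda>\<tau>. v \<tau> x - - 1 * H (u \<tau> x)) has_real_derivative
        u t x powr (2 * \<theta>) * (v\<^sub>x t x - - 1 * u t x powr (2 * \<theta>) * u\<^sub>x t x)
        - a t / 2 * (v t x - 1 * H (u t x) + (v t x - - 1 * H (u t x)))) (at t within {0..<T})"
      by (rule DERIV_cong[OF invariant_t[OF t]]) (auto simp: algebra_simps)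
    show "\<bar>u t x powr (2 * \<theta>)\<bar> \<le> l powr (2 * \<theta>)"
      using u_ge[OF t, of x] l theta by (auto intro: powr_mono2')
    show "0 \<le> a t / 2" using a_nonneg[OF t] by simp
    have "H l \<le> H (u t x)" "H (u t x) \<le> H N"
      using u_ge[OF t, of x] u_le[OF t, of x] l by (auto intro: powr_primitive_mono)
    then show "max \<bar>v t x - 1 * H (u t x)\<bar> \<bar>v t x - - 1 * H (u t x)\<bar> \<le> N + \<bar>H l\<bar> + \<bar>H N\<bar>"
      using v_bdd[OF t, of x] by linarith
  qed (use t init[folded max_eq] in \<open>blast intro: invariant_x invariant_x_cont\<close>)+
  then show ?thesis by (simp only: max_eq)
qed

lemma speed_x:
  assumes "t \<in> {0..<T}"
  shows "((\<lambda>x. \<sigma> * u t x powr (2 * \<theta>)) has_real_derivative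
      \<sigma> * (2 * \<theta> * u t x powr (2 * \<theta> - 1) * u\<^sub>x t x)) (at x)"
  by (rule DERIV_cmult[OF DERIV_chain2[OF has_real_derivative_powr[OF u_pos] u_x]]) (use assms in auto)

text \<open>Since u stays above l and its x derivative is bounded, the speed is Lipschitz in x
  uniformly in time, so the characteristic lives on all of {0..b}.\<close>

lemma characteristic_exists:
  assumes b: "b \<in> {0..<T}" and \<sigma>: "\<bar>\<sigma>\<bar> = 1"
  obtains X where "X 0 = z" "\<And>t. t \<in> {0..b} \<Longrightarrow>
    (X has_real_derivative \<sigma> * u t (X t) powr (2 * \<theta>)) (at t within {0..b})"
proof (rule picard_lindelof_interval[of b "\<lambda>t x. \<sigma> * u t x powr (2 * \<theta>)"
      "2 * \<bar>\<theta>\<bar> * l powr (2 * \<theta> - 1) * N" z])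
  have sub: "{0..b} \<times> UNIV \<subseteq> {0..<T} \<times> UNIV" using b by auto
  have "continuous_on ({0..<T} \<times> UNIV) (\<lambda>(t, x). \<sigma> * u t x powr (2 * \<theta>))"
    using u_powr_cont[of "2 * \<theta>"] unfolding case_prod_unfold by (intro continuous_on_diff continuous_on_mult continuous_on_const)
  then show "continuous_on ({0..b} \<times> UNIV) (\<lambda>(t, x). \<sigma> * u t x powr (2 * \<theta>))"
    by (rule continuous_on_subset[OF _ sub])
  fix t x y assume "t \<in> {0..b}"
  then have t: "t \<in> {0..<T}" using b by auto
  have "norm (\<sigma> * u t x powr (2 * \<theta>) - \<sigma> * u t y powr (2 * \<theta>))
      \<le> 2 * \<bar>\<theta>\<bar> * l powr (2 * \<theta> - 1) * N * norm (x - y)"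
  proof (rule field_differentiable_bound[of UNIV])
    fix z
    show "((\<lambda>x. \<sigma> * u t x powr (2 * \<theta>)) has_real_derivative
      \<sigma> * (2 * \<theta> * u t z powr (2 * \<theta> - 1) * u\<^sub>x t z)) (at z within UNIV)"
      using speed_x[OF t] by simp
    have "2 * \<bar>\<theta>\<bar> * u t z powr (2 * \<theta> - 1) * \<bar>u\<^sub>x t z\<bar> \<le> 2 * \<bar>\<theta>\<bar> * l powr (2 * \<theta> - 1) * N"
      using u_ge[OF t, of z] l theta by (intro mult_mono mult_left_mono powr_mono2' u\<^sub>x_bdd t) (auto intro: mult_nonpos_nonneg)
    then show "norm (\<sigma> * (2 * \<theta> * u t z powr (2 * \<theta> - 1) * u\<^sub>x t z)) \<le> 2 * \<bar>\<theta>\<bar> * l powr (2 * \<theta> - 1) * N"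
      using \<sigma> by (simp add: abs_mult)
  qed auto
  then show "\<bar>\<sigma> * u t x powr (2 * \<theta>) - \<sigma> * u t y powr (2 * \<theta>)\<bar>
      \<le> 2 * \<bar>\<theta>\<bar> * l powr (2 * \<theta> - 1) * N * \<bar>x - y\<bar>" by simp
qed (use b that in auto)

text \<open>Along a characteristic \<open>u\<close> changes at the rate \<open>v\<^sub>x + \<sigma> c u\<^sub>x\<close>, which is the slope of the other
  Riemann invariant. This turns the coupling between the two families into an exact derivative.\<close>

lemma weighted_slope_riccati:
  assumes b: "b \<in> {0..<T}" and \<sigma>: "\<sigma> * \<sigma> = 1"
    and X: "\<And>t. t \<in> {0..b} \<Longrightarrow> (X has_real_derivative \<sigma> * u t (X t) powr (2 * \<theta>)) (at t within {0..b})"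
    and t: "t \<in> {0..b}"
  defines "y \<equiv> \<lambda>t. u t (X t) powr \<theta> * (v\<^sub>x t (X t) - \<sigma> * u t (X t) powr (2 * \<theta>) * u\<^sub>x t (X t))"
    and "G' \<equiv> \<lambda>t. u t (X t) powr \<theta> * (v\<^sub>x t (X t) + \<sigma> * u t (X t) powr (2 * \<theta>) * u\<^sub>x t (X t))"
  shows "((\<lambda>t. G (u t (X t))) has_real_derivative G' t) (at t within {0..b})"
    and "(y has_real_derivative - (- \<theta> * u t (X t) powr (- \<theta>) / u t (X t)) * (y t)\<^sup>2
          - a t / 2 * y t - a t / 2 * G' t) (at t within {0..b})"
proof -
  have sub: "{0..b} \<times> UNIV \<subseteq> {0..<T} \<times> UNIV" and sub1: "{0..b} \<subseteq> {0..<T}" using b by auto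
  have T: "\<tau> \<in> {0..<T}" if "\<tau> \<in> {0..b}" for \<tau> using that b by auto
  define U c p p' q S R where "U = u t (X t)" and "c = U powr (2 * \<theta>)" and "p = U powr \<theta>"
    and "p' = U powr (\<theta> - 1)" and "q = U powr (2 * \<theta> - 1)"
    and "S = v\<^sub>x t (X t) + \<sigma> * c * u\<^sub>x t (X t)" and "R = v\<^sub>x t (X t) - \<sigma> * c * u\<^sub>x t (X t)"
  note abbrs = U_def c_def p_def p'_def q_def S_def R_def
  have U: "U > 0" unfolding U_def by (rule u_pos[OF T[OF t]])
  have Du: "((\<lambda>t. u t (X t)) has_real_derivative S) (at t within {0..b})"
    by (rule DERIV_cong[OF has_real_derivative_along_curve[where w = u and X = X and wx = u\<^sub>x,
          OF has_field_derivative_subset[OF u_t sub1] u_x continuous_on_subset[OF u\<^sub>x_cont sub] X t]])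
       (use T t in \<open>auto simp: S_def c_def U_def\<close>)
  show "((\<lambda>t. G (u t (X t))) has_real_derivative G' t) (at t within {0..b})"
    unfolding G'_def
    by (rule DERIV_cong[OF DERIV_chain2[OF has_real_derivative_powr_primitive Du]])
       (use u_pos T t in \<open>auto simp: abbrs\<close>)
  have DR: "((\<lambda>t. v\<^sub>x t (X t) - \<sigma> * u t (X t) powr (2 * \<theta>) * u\<^sub>x t (X t)) has_real_derivative
      - a t * v\<^sub>x t (X t) - \<sigma> * (2 * \<theta> * q * u\<^sub>x t (X t)) * R) (at t within {0..b})"
    unfolding abbrs
  proof (rule slope_along_characteristic[where w = "\<lambda>t x. v t x - \<sigma> * H (u t x)" and
        s = "\<lambda>t x. \<sigma> * u t x powr (2 * \<theta>)" and q = "\<lambda>t x. - a t * v t x" and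
        w' = "\<lambda>t x. v\<^sub>x t x - \<sigma> * u t x powr (2 * \<theta>) * u\<^sub>x t x" and
        s' = "\<lambda>t x. \<sigma> * (2 * \<theta> * u t x powr (2 * \<theta> - 1) * u\<^sub>x t x)" and
        q' = "\<lambda>t x. - a t * v\<^sub>x t x" and b = b and X = X and t = t])
    fix t x assume "t \<in> {0..b}"
    then have t: "t \<in> {0..<T}" by (rule T)
    show "((\<lambda>\<tau>. v \<tau> x - \<sigma> * H (u \<tau> x)) has_real_derivative
      - a t * v t x - \<sigma> * u t x powr (2 * \<theta>) * (v\<^sub>x t x - \<sigma> * u t x powr (2 * \<theta>) * u\<^sub>x t x))
      (at t within {0..b})"
      by (rule has_field_derivative_subset[OF invariant_t[OF t \<sigma>] sub1])
    show "((\<lambda>x. - a t * v t x) has_real_derivative - a t * v\<^sub>x t x) (at x)"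
      by (rule DERIV_cmult[OF v_x[OF t]])
  next
    show "continuous_on ({0..b} \<times> UNIV) (\<lambda>(t, x). \<sigma> * (2 * \<theta> * u t x powr (2 * \<theta> - 1) * u\<^sub>x t x))"
      using continuous_on_subset[OF u\<^sub>x_cont sub] continuous_on_subset[OF u_powr_cont[of "2 * \<theta> - 1"] sub]
      unfolding case_prod_unfold by (intro continuous_on_diff continuous_on_mult continuous_on_const)
    have "continuous_on ({0..b} \<times> (UNIV :: real set)) (\<lambda>z. a (fst z))"
      by (rule continuous_on_compose2[OF continuous_on_subset[OF a_cont sub1] continuous_on_fst[OF continuous_on_id]]) auto
    then show "continuous_on ({0..b} \<times> UNIV) (\<lambda>(t, x). - a t * v\<^sub>x t x)"
      using continuous_on_subset[OF v\<^sub>x_cont sub]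
      unfolding case_prod_unfold by (intro continuous_on_minus continuous_on_diff continuous_on_mult continuous_on_const)
  qed (use X t T invariant_x speed_x continuous_on_subset[OF invariant_x_cont sub] in blast)+
  have Dp: "((\<lambda>t. u t (X t) powr \<theta>) has_real_derivative \<theta> * p' * S) (at t within {0..b})"
    by (rule DERIV_cong[OF DERIV_chain2[OF has_real_derivative_powr Du]])
       (use U in \<open>auto simp: U_def p'_def\<close>)
  have pq: "p * q = p' * c" by (simp add: abbrs flip: powr_add)
  have pp: "U powr (- \<theta>) / U * (p * p) = p'"
    using U by (simp add: p_def p'_def powr_minus powr_diff field_simps)
  have yt: "y t = p * R" and G't: "G' t = p * S" by (simp_all add: y_def G'_def abbrs)
  show "(y has_real_derivative - (- \<theta> * u t (X t) powr (- \<theta>) / u t (X t)) * (y t)\<^sup>2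
          - a t / 2 * y t - a t / 2 * G' t) (at t within {0..b})"
    unfolding yt G't U_def[symmetric]
  proof (rule DERIV_cong)
    show "(y has_real_derivative \<theta> * p' * S * R + (- a t * v\<^sub>x t (X t) - \<sigma> * (2 * \<theta> * q * u\<^sub>x t (X t)) * R) * p)
      (at t within {0..b})"
      unfolding y_def using DERIV_mult[OF Dp DR] by (simp add: abbrs)
    \<comment> \<open>The derivative of the weight contributes S * R, that of the speed contributes
      u_x * R. With this weight they combine to S - 2 \<sigma> c u_x, which is R again.\<close>
    have "\<theta> * p' * S * R - \<sigma> * (2 * \<theta> * q * u\<^sub>x t (X t)) * R * p
        = \<theta> * R * (p' * S - 2 * \<sigma> * u\<^sub>x t (X t) * (p * q))" by (simp add: algebra_simps)
    also have "\<dots> = \<theta> * R * p' * (S - 2 * \<sigma> * c * u\<^sub>x t (X t))" unfolding pq by (simp add: algebra_simps)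
    also have "S - 2 * \<sigma> * c * u\<^sub>x t (X t) = R" by (simp add: S_def R_def)
    also have "\<theta> * R * p' * R = \<theta> * (U powr (- \<theta>) / U * (p * p)) * R * R" unfolding pp by simp
    finally have *: "\<theta> * p' * S * R - \<sigma> * (2 * \<theta> * q * u\<^sub>x t (X t)) * R * p
        = - (- \<theta> * U powr (- \<theta>) / U) * (p * R)\<^sup>2"
      by (simp add: power2_eq_square)
    \<comment> \<open>This splits the damping into a part proportional to y and one proportional to
      the derivative of G u.\<close>
    have "v\<^sub>x t (X t) = (R + S) / 2" by (simp add: S_def R_def)
    then have "- a t * v\<^sub>x t (X t) * p = - a t / 2 * (p * R) - a t / 2 * (p * S)"
      by (simp add: algebra_simps add_divide_distrib)
    with * show "\<theta> * p' * S * R + (- a t * v\<^sub>x t (X t) - \<sigma> * (2 * \<theta> * q * u\<^sub>x t (X t)) * R) * p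
      = - (- \<theta> * U powr (- \<theta>) / U) * (p * R)\<^sup>2 - a t / 2 * (p * R) - a t / 2 * (p * S)"
      by (simp only: left_diff_distrib)
  qed
qed

end

locale weighted_p_system = damped_p_system + damping_weights
begin

lemma lifespan_weight_bound:
  assumes range: "\<And>t x. t \<in> {0..<T} \<Longrightarrow> u t x \<in> {1/2..2}"
    and G_le: "\<And>t x. t \<in> {0..<T} \<Longrightarrow> \<bar>G (u t x)\<bar> \<le> g"
    and \<sigma>: "\<bar>\<sigma>\<bar> = 1" and \<epsilon>: "\<epsilon> > 0"
    and init: "u 0 z powr \<theta> * (v\<^sub>x 0 z - \<sigma> * u 0 z powr (2 * \<theta>) * u\<^sub>x 0 z)
        \<le> - \<epsilon> - 2 * g * (F1 + P1) - P1 * g"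
    and t: "t \<in> {0..<T}"
  shows "B t \<le> 4 / (- \<theta> * (1/2) powr (- \<theta>) / 2 * \<epsilon>)"
proof -
  have \<sigma>2: "\<sigma> * \<sigma> = 1" using \<sigma> by (metis abs_mult_self_eq mult_1)
  obtain X where X0: "X 0 = z" and X: "\<And>\<tau>. \<tau> \<in> {0..t} \<Longrightarrow>
    (X has_real_derivative \<sigma> * u \<tau> (X \<tau>) powr (2 * \<theta>)) (at \<tau> within {0..t})"
    using characteristic_exists[OF t \<sigma>] by blast
  note riccati = weighted_slope_riccati[OF t \<sigma>2 X]
  show ?thesis
  proof (rule riccati_blowup[OF _ riccati(2) riccati(1)])
    show "u 0 (X 0) powr \<theta> * (v\<^sub>x 0 (X 0) - \<sigma> * u 0 (X 0) powr (2 * \<theta>) * u\<^sub>x 0 (X 0))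
        \<le> - \<epsilon> - 2 * g * (F1 + P1) - P1 * g" using init X0 by simp
    fix \<tau> assume "\<tau> \<in> {0..t}"
    then have \<tau>: "\<tau> \<in> {0..<T}" using t by auto
    show "\<bar>G (u \<tau> (X \<tau>))\<bar> \<le> g" by (rule G_le[OF \<tau>])
    let ?U = "u \<tau> (X \<tau>)"
    \<comment> \<open>The sign of the exponent - \<theta> - 1 is not fixed; bounding the quotient
      keeps numerator and denominator each monotone in u.\<close>
    have "(1/2) powr (- \<theta>) / 2 \<le> ?U powr (- \<theta>) / ?U"
      using range[OF \<tau>, of "X \<tau>"] theta by (intro frac_le powr_mono2) auto
    then have "- \<theta> * ((1/2) powr (- \<theta>) / 2) \<le> - \<theta> * (?U powr (- \<theta>) / ?U)"
      using theta by (intro mult_left_mono) auto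
    then show "- \<theta> * (1/2) powr (- \<theta>) / 2 \<le> - \<theta> * ?U powr (- \<theta>) / ?U" by simp
  qed (use t theta \<epsilon> in \<open>auto simp: mult_neg_pos\<close>)
qed

end

section \<open>Damping weights\<close>

text \<open>Here a is integrable, so A increases to the finite limit A1. P' is (a^2 / 4 + a' / 2) *
  A; both powers of 1 + t in it decay at least like (1 + t) powr (- \<mu>), and M adds up their
  coefficients. Replacing A by A1 gives the linear B.\<close>

lemma damping_weights_integrable:
  fixes \<mu> lam :: real
  assumes \<mu>: "\<mu> > 1" and lam: "lam \<ge> 0"
  defines "A1 \<equiv> exp (lam / (2 * (\<mu> - 1)))" and "M \<equiv> lam\<^sup>2 / 4 + lam * \<mu> / 2"
  defines "A \<equiv> \<lambda>t. exp (lam / (2 * (\<mu> - 1)) * (1 - (1 + t) powr (1 - \<mu>)))"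
  shows "damping_weights (\<lambda>t. lam / (1 + t) powr \<mu>) A
    (\<lambda>t. lam / 2 * (1 + t) powr (- \<mu>) * A t)
    (\<lambda>t. (lam\<^sup>2 / 4 * (1 + t) powr (- 2 * \<mu>) - lam * \<mu> / 2 * (1 + t) powr (- \<mu> - 1)) * A t)
    (\<lambda>t. A1 * M / (\<mu> - 1) * (1 - (1 + t) powr (1 - \<mu>))) (\<lambda>t. A1 * M * (1 + t) powr (- \<mu>))
    (\<lambda>t. t / A1) (\<lambda>t. 1 / A1) (lam / 2 * A1) (A1 * M / (\<mu> - 1))"
proof
  fix t :: real assume t: "t \<ge> 0"
  have A_le: "A t \<le> A1"
  proof -
    have "lam / (2 * (\<mu> - 1)) * (1 - (1 + t) powr (1 - \<mu>)) \<le> lam / (2 * (\<mu> - 1))"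
      using \<mu> lam by (intro mult_left_le) auto
    then show ?thesis by (simp add: A_def A1_def)
  qed
  have M: "M \<ge> 0" using lam \<mu> by (simp add: M_def)
  have powr_le: "(1 + t) powr p \<le> (1 + t) powr q" if "p \<le> q" for p q
    using that t by (intro powr_mono) auto
  show "0 < A t" by (simp add: A_def)
  show A': "(A has_real_derivative lam / 2 * (1 + t) powr (- \<mu>) * A t) (at t)"
    unfolding A_def using t \<mu> by (auto intro!: derivative_eq_intros) (simp add: field_simps)
  show "lam / 2 * (1 + t) powr (- \<mu>) * A t = lam / (1 + t) powr \<mu> / 2 * A t"
    by (simp add: powr_minus_divide)
  have sq: "(1 + t) powr (- 2 * \<mu>) = (1 + t) powr (- \<mu>) * (1 + t) powr (- \<mu>)"
    by (simp flip: powr_add)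
  have "((\<lambda>t. lam / 2 * (1 + t) powr (- \<mu>)) has_real_derivative - (lam * \<mu> / 2 * (1 + t) powr (- \<mu> - 1))) (at t)"
    using t by (auto intro!: derivative_eq_intros)
  from DERIV_mult[OF this A']
  show "((\<lambda>t. lam / 2 * (1 + t) powr (- \<mu>) * A t) has_real_derivative
      (lam\<^sup>2 / 4 * (1 + t) powr (- 2 * \<mu>) - lam * \<mu> / 2 * (1 + t) powr (- \<mu> - 1)) * A t) (at t)"
    unfolding sq by (rule DERIV_cong) (simp add: algebra_simps power2_eq_square)
  show "\<bar>lam / 2 * (1 + t) powr (- \<mu>) * A t\<bar> \<le> lam / 2 * A1"
  proof -
    have "lam / 2 * (1 + t) powr (- \<mu>) * A t \<le> lam / 2 * 1 * A1"
      using A_le lam powr_le[of "- \<mu>" 0] \<mu> t by (intro mult_mono mult_left_mono) (auto simp: A_def)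
    then show ?thesis using lam by (simp add: A_def)
  qed
  show "((\<lambda>t. A1 * M / (\<mu> - 1) * (1 - (1 + t) powr (1 - \<mu>))) has_real_derivative A1 * M * (1 + t) powr (- \<mu>)) (at t)"
    using t \<mu> by (auto intro!: derivative_eq_intros) (simp add: field_simps)
  show "\<bar>(lam\<^sup>2 / 4 * (1 + t) powr (- 2 * \<mu>) - lam * \<mu> / 2 * (1 + t) powr (- \<mu> - 1)) * A t\<bar>
      \<le> A1 * M * (1 + t) powr (- \<mu>)"
  proof -
    have "\<bar>lam\<^sup>2 / 4 * (1 + t) powr (- 2 * \<mu>) - lam * \<mu> / 2 * (1 + t) powr (- \<mu> - 1)\<bar>
        \<le> lam\<^sup>2 / 4 * (1 + t) powr (- 2 * \<mu>) + lam * \<mu> / 2 * (1 + t) powr (- \<mu> - 1)"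
      using lam \<mu> by (intro abs_leI) auto
    also have "\<dots> \<le> lam\<^sup>2 / 4 * (1 + t) powr (- \<mu>) + lam * \<mu> / 2 * (1 + t) powr (- \<mu>)"
      using lam \<mu> by (intro add_mono mult_left_mono powr_le) auto
    also have "\<dots> = M * (1 + t) powr (- \<mu>)" by (simp add: M_def algebra_simps)
    finally have "\<bar>lam\<^sup>2 / 4 * (1 + t) powr (- 2 * \<mu>) - lam * \<mu> / 2 * (1 + t) powr (- \<mu> - 1)\<bar> * \<bar>A t\<bar>
        \<le> M * (1 + t) powr (- \<mu>) * A1"
      using M A_le by (intro mult_mono) (auto simp: A_def)
    then show ?thesis by (simp add: abs_mult mult_ac)
  qed
  show "A1 * M / (\<mu> - 1) * (1 - (1 + t) powr (1 - \<mu>)) \<le> A1 * M / (\<mu> - 1)"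
    using M \<mu> by (intro mult_left_le) (auto simp: A1_def)
  show "((\<lambda>t. t / A1) has_real_derivative 1 / A1) (at t)"
    by (rule DERIV_cdivide) simp
  show "1 / A1 \<le> 1 / A t" using A_le by (intro frac_le) (auto simp: A_def)
qed (auto simp: A_def)

text \<open>For lam at most 2 the function P is nonincreasing, so its variation up to t is just P 0
  - P t and serves as F. B is the exact integral of 1 / A.\<close>

lemma damping_weights_critical:
  fixes \<mu> lam :: real
  assumes \<mu>: "\<mu> = 1" and lam: "0 \<le> lam" "lam \<le> 2"
  shows "damping_weights (\<lambda>t. lam / (1 + t) powr \<mu>) (\<lambda>t. (1 + t) powr (lam / 2))
    (\<lambda>t. lam / 2 * (1 + t) powr (lam / 2 - 1)) (\<lambda>t. lam / 2 * (lam / 2 - 1) * (1 + t) powr (lam / 2 - 2))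
    (\<lambda>t. lam / 2 - lam / 2 * (1 + t) powr (lam / 2 - 1))
    (\<lambda>t. - (lam / 2 * (lam / 2 - 1) * (1 + t) powr (lam / 2 - 2)))
    (\<lambda>t. powr_primitive (- lam / 2) (1 + t)) (\<lambda>t. (1 + t) powr (- lam / 2)) (lam / 2) (lam / 2)"
proof
  fix t :: real assume t: "t \<ge> 0"
  show "0 < (1 + t) powr (lam / 2)" using t by simp
  show "((\<lambda>t. (1 + t) powr (lam / 2)) has_real_derivative lam / 2 * (1 + t) powr (lam / 2 - 1)) (at t)"
    using t by (auto intro!: derivative_eq_intros)
  show "lam / 2 * (1 + t) powr (lam / 2 - 1) = lam / (1 + t) powr \<mu> / 2 * (1 + t) powr (lam / 2)"
    using t \<mu> by (simp add: powr_diff)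
  have two: "lam / 2 - 1 - 1 = lam / 2 - 2" by simp
  have powr': "((\<lambda>t. (1 + t) powr p) has_real_derivative p * (1 + t) powr (p - 1)) (at t)" for p
    using t by (auto intro!: derivative_eq_intros)
  show P': "((\<lambda>t. lam / 2 * (1 + t) powr (lam / 2 - 1)) has_real_derivative
      lam / 2 * (lam / 2 - 1) * (1 + t) powr (lam / 2 - 2)) (at t)"
    using DERIV_cmult[OF powr'[of "lam / 2 - 1"], of "lam / 2"] by (simp only: two mult.assoc)
  have "(1 + t) powr (lam / 2 - 1) \<le> (1 + t) powr 0" using t lam by (intro powr_mono) auto
  then have "(1 + t) powr (lam / 2 - 1) \<le> 1" using t by simp
  from mult_left_mono[OF this, of "lam / 2"]
  show "\<bar>lam / 2 * (1 + t) powr (lam / 2 - 1)\<bar> \<le> lam / 2" using lam by simp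
  show "((\<lambda>t. lam / 2 - lam / 2 * (1 + t) powr (lam / 2 - 1)) has_real_derivative
      - (lam / 2 * (lam / 2 - 1) * (1 + t) powr (lam / 2 - 2))) (at t)"
    using DERIV_diff[OF DERIV_const P', of "lam / 2"] by simp
  have "lam / 2 * (lam / 2 - 1) \<le> 0" using lam by (intro mult_nonneg_nonpos) auto
  then show "\<bar>lam / 2 * (lam / 2 - 1) * (1 + t) powr (lam / 2 - 2)\<bar>
      \<le> - (lam / 2 * (lam / 2 - 1) * (1 + t) powr (lam / 2 - 2))"
    by (rule eq_refl[OF abs_of_nonpos[OF mult_nonpos_nonneg]]) auto
  show "lam / 2 - lam / 2 * (1 + t) powr (lam / 2 - 1) \<le> lam / 2" using lam by simp
  have "((\<lambda>t. 1 + t) has_real_derivative 1) (at t)" by (auto intro!: derivative_eq_intros)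
  from DERIV_chain2[OF has_real_derivative_powr_primitive this, of "- lam / 2"]
  show "((\<lambda>t. powr_primitive (- lam / 2) (1 + t)) has_real_derivative (1 + t) powr (- lam / 2)) (at t)"
    using t by simp
  show "(1 + t) powr (- lam / 2) \<le> 1 / (1 + t) powr (lam / 2)"
    by (simp add: powr_minus_divide)
qed auto

definition lifespan_bound :: "real \<Rightarrow> real \<Rightarrow> real \<Rightarrow> real \<Rightarrow> real" where
  "lifespan_bound \<mu> lam C \<epsilon> =
    (if \<mu> > 1 then C * \<epsilon> powr (-1) else if lam < 2 then C * \<epsilon> powr (- (2 / (2 - lam))) else exp (C / \<epsilon>))"

text \<open>Solving B t \<le> c / \<epsilon> for t gives the rate in each regime; C is fixed before
  \<epsilon> and t.\<close>

lemma damping_weights_exist: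
  fixes \<mu> lam :: real
  assumes "(\<mu> > 1 \<and> lam \<ge> 0) \<or> (\<mu> = 1 \<and> 0 \<le> lam \<and> lam \<le> 2)"
  obtains A P P' F F' B B' P1 F1 where
    "damping_weights (\<lambda>t. lam / (1 + t) powr \<mu>) A P P' F F' B B' P1 F1"
    "\<And>c. c > 0 \<Longrightarrow> \<exists>C>0. \<forall>\<epsilon> t. 0 < \<epsilon> \<longrightarrow> \<epsilon> \<le> 1 \<longrightarrow> 0 \<le> t \<longrightarrow> B t \<le> c / \<epsilon> \<longrightarrow> t \<le> lifespan_bound \<mu> lam C \<epsilon>"
proof -
  consider "\<mu> > 1" "lam \<ge> 0" | "\<mu> = 1" "0 \<le> lam" "lam < 2" | "\<mu> = 1" "lam = 2"
    using assms by fastforce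
  then show thesis
  proof cases
    case 1
    show thesis
    proof (rule that[OF damping_weights_integrable[OF 1]])
      fix c :: real assume c: "c > 0"
      let ?A = "exp (lam / (2 * (\<mu> - 1)))"
      show "\<exists>C>0. \<forall>\<epsilon> t. 0 < \<epsilon> \<longrightarrow> \<epsilon> \<le> 1 \<longrightarrow> 0 \<le> t \<longrightarrow> t / ?A \<le> c / \<epsilon> \<longrightarrow> t \<le> lifespan_bound \<mu> lam C \<epsilon>"
        using 1 c by (intro exI[of _ "c * ?A"])
          (auto simp: lifespan_bound_def powr_minus_divide pos_divide_le_eq mult_ac)
    qed
  next
    case 2
    define q where "q = 1 - lam / 2"
    have q: "q > 0" "1 / q = 2 / (2 - lam)" using 2 by (auto simp: q_def field_simps)
    show thesis
    proof (rule that[OF damping_weights_critical[of \<mu> lam]])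
      fix c :: real assume c: "c > 0"
      show "\<exists>C>0. \<forall>\<epsilon> t. 0 < \<epsilon> \<longrightarrow> \<epsilon> \<le> 1 \<longrightarrow> 0 \<le> t \<longrightarrow> powr_primitive (- lam / 2) (1 + t) \<le> c / \<epsilon>
          \<longrightarrow> t \<le> lifespan_bound \<mu> lam C \<epsilon>"
      proof (intro exI[of _ "(1 + q * c) powr (1 / q)"] conjI allI impI)
        have "1 + q * c > 0" by (intro add_pos_pos mult_pos_pos q c zero_less_one)
        then show "(1 + q * c) powr (1 / q) > 0" by simp
        fix \<epsilon> t :: real
        assume \<epsilon>: "0 < \<epsilon>" "\<epsilon> \<le> 1" and t: "0 \<le> t" and B: "powr_primitive (- lam / 2) (1 + t) \<le> c / \<epsilon>"
        have "powr_primitive (- lam / 2) (1 + t) = ((1 + t) powr q - 1) / q"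
          using 2 by (auto simp: powr_primitive_def q_def)
        with B have "((1 + t) powr q - 1) / q \<le> c / \<epsilon>" by simp
        from mult_left_mono[OF this, of q] q have "(1 + t) powr q \<le> 1 + q * c / \<epsilon>" by simp
        \<comment> \<open>The restriction to \<epsilon> \<le> 1 lets 1 / \<epsilon> absorb the
          additive 1.\<close>
        also have "\<dots> \<le> (1 + q * c) / \<epsilon>" using \<epsilon> by (simp add: field_simps)
        finally have "((1 + t) powr q) powr (1 / q) \<le> ((1 + q * c) / \<epsilon>) powr (1 / q)"
          using q(1) by (intro powr_mono2) auto
        then have "1 + t \<le> ((1 + q * c) / \<epsilon>) powr (1 / q)" using q(1) t by (simp add: powr_powr)
        also have "\<dots> = (1 + q * c) powr (1 / q) * \<epsilon> powr (- (1 / q))"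
          using q(1) c \<epsilon> by (simp add: powr_divide powr_minus_divide)
        finally show "t \<le> lifespan_bound \<mu> lam ((1 + q * c) powr (1 / q)) \<epsilon>"
          using 2 by (simp add: lifespan_bound_def q(2))
      qed
    qed (use 2 in auto)
  next
    case 3
    show thesis
    proof (rule that[OF damping_weights_critical[of \<mu> lam]])
      fix c :: real assume c: "c > 0"
      show "\<exists>C>0. \<forall>\<epsilon> t. 0 < \<epsilon> \<longrightarrow> \<epsilon> \<le> 1 \<longrightarrow> 0 \<le> t \<longrightarrow> powr_primitive (- lam / 2) (1 + t) \<le> c / \<epsilon>
          \<longrightarrow> t \<le> lifespan_bound \<mu> lam C \<epsilon>"
      proof (intro exI[of _ c] conjI allI impI c)
        fix \<epsilon> t :: real assume t: "0 \<le> t" and "powr_primitive (- lam / 2) (1 + t) \<le> c / \<epsilon>"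
        then have "ln (1 + t) \<le> c / \<epsilon>" using 3 by (simp add: powr_primitive_def)
        then have "exp (ln (1 + t)) \<le> exp (c / \<epsilon>)" by simp
        then have "1 + t \<le> exp (c / \<epsilon>)" using t by simp
        then show "t \<le> lifespan_bound \<mu> lam c \<epsilon>" using 3 by (simp add: lifespan_bound_def)
      qed
    qed (use 3 in auto)
  qed
qed

section \<open>Size of the primitives near the constant state\<close>

text \<open>Mean value theorem from the zero at 1. The upper estimate controls H of the data and G
  u; the lower one recovers u - 1 from H u.\<close>

lemma powr_primitive_bounds:
  assumes w: "w \<in> {1/2..2}" and p: "p < 0"
  shows "\<bar>powr_primitive p w\<bar> \<le> (1/2) powr p * \<bar>w - 1\<bar>"
    and "2 powr p * \<bar>w - 1\<bar> \<le> \<bar>powr_primitive p w\<bar>"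
proof -
  have "\<exists>\<xi>\<in>{1/2..2}. \<bar>powr_primitive p w\<bar> = \<xi> powr p * \<bar>w - 1\<bar>"
  proof (cases "w = 1")
    case True
    then show ?thesis by (intro bexI[of _ 1]) auto
  next
    case False
    then consider "w < 1" | "1 < w" by linarith
    then show ?thesis
    proof cases
      case 1
      obtain \<xi> where "w < \<xi>" "\<xi> < 1" "powr_primitive p 1 - powr_primitive p w = (1 - w) * \<xi> powr p"
        using MVT2[OF 1, of "powr_primitive p" "\<lambda>\<xi>. \<xi> powr p"] has_real_derivative_powr_primitive w by auto
      then show ?thesis using w by (intro bexI[of _ \<xi>]) (auto simp: abs_mult simp flip: abs_minus_cancel[of "powr_primitive p w"])
    next
      case 2
      obtain \<xi> where "1 < \<xi>" "\<xi> < w" "powr_primitive p w - powr_primitive p 1 = (w - 1) * \<xi> powr p"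
        using MVT2[OF 2, of "powr_primitive p" "\<lambda>\<xi>. \<xi> powr p"] has_real_derivative_powr_primitive by auto
      then show ?thesis using w by (intro bexI[of _ \<xi>]) (auto simp: abs_mult)
    qed
  qed
  then obtain \<xi> where \<xi>: "\<xi> \<in> {1/2..2}" "\<bar>powr_primitive p w\<bar> = \<xi> powr p * \<bar>w - 1\<bar>" by blast
  show "\<bar>powr_primitive p w\<bar> \<le> (1/2) powr p * \<bar>w - 1\<bar>"
    unfolding \<xi>(2) using \<xi>(1) p by (intro mult_right_mono powr_mono2') auto
  show "2 powr p * \<bar>w - 1\<bar> \<le> \<bar>powr_primitive p w\<bar>"
    unfolding \<xi>(2) using \<xi>(1) p by (intro mult_right_mono powr_mono2') auto
qed

text \<open>\<open>enn2real\<close> sends infinity to 0, so the norm must first be shown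
  finite.\<close>

lemma abs_le_Linf_norm:
  assumes "bounded (range f)"
  shows "\<bar>f x\<bar> \<le> enn2real (Linf_norm f)"
proof -
  from assms obtain M where M: "\<And>x. \<bar>f x\<bar> \<le> M" by (auto simp: bounded_iff)
  have "Linf_norm f \<le> ennreal M"
    unfolding Linf_norm_def by (intro SUP_least ennreal_leI M)
  then have "Linf_norm f < top" by (rule le_less_trans) simp
  moreover have "ennreal \<bar>f x\<bar> \<le> Linf_norm f"
    unfolding Linf_norm_def by (rule SUP_upper) simp
  ultimately show ?thesis by (metis ennreal_enn2real ennreal_le_iff enn2real_nonneg)
qed

section \<open>Small data\<close>

context damped_p_system
begin

lemma in_C1b:
  assumes t: "t \<in> {0..<T}"
  shows "u t \<in> C1b" "v t \<in> C1b"
proof -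
  have slice: "continuous_on UNIV (\<lambda>x. f t x)"
    if "continuous_on ({0..<T} \<times> UNIV) (\<lambda>(t, x). f t x)" for f :: "real \<Rightarrow> real \<Rightarrow> real"
  proof -
    have "continuous_on UNIV (Pair t)" "range (Pair t) \<subseteq> {0..<T} \<times> UNIV"
      using t by (auto intro!: continuous_intros)
    from continuous_on_compose2[OF that this] show ?thesis by simp
  qed
  have C1: "f C1_differentiable_on UNIV" "deriv f = f'"
    if "\<And>x. (f has_real_derivative f' x) (at x)" "continuous_on UNIV f'" for f f' :: "real \<Rightarrow> real"
    using that DERIV_imp_deriv unfolding C1_differentiable_on_def
    by (auto simp: fun_eq_iff has_real_derivative_iff_has_vector_derivative[symmetric])
  have b: "bounded (range f)" if "\<And>x. \<bar>f x\<bar> \<le> N" for f :: "real \<Rightarrow> real"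
    using that by (auto simp: bounded_iff)
  have "\<bar>u t x\<bar> \<le> N" for x using u_le[OF t, of x] u_pos[OF t, of x] by simp
  then show "u t \<in> C1b"
    using C1[OF u_x[OF t] slice[OF u\<^sub>x_cont]] b u\<^sub>x_bdd[OF t] by (simp add: C1b_def)
  show "v t \<in> C1b"
    using C1[OF v_x[OF t] slice[OF v\<^sub>x_cont]] b u\<^sub>x_bdd[OF t] v\<^sub>x_bdd[OF t] v_bdd[OF t] by (simp add: C1b_def)
qed

end

text \<open>\<open>size_const \<theta> p q * \<epsilon>\<close> bounds the amplitude of solutions with data \<open>(1 + \<epsilon> \<phi>, \<epsilon> \<psi>)\<close>, where \<open>p\<close> and \<open>q\<close>
  bound \<open>\<phi>\<close> and \<open>\<psi>\<close>.\<close>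

definition size_const :: "real \<Rightarrow> real \<Rightarrow> real \<Rightarrow> real" where
  "size_const \<theta> p q = q + (1/2) powr (2 * \<theta>) * p"

text \<open>Division by 2 powr (2 * \<theta>) passes from H u to u - 1, and the factor (1/2) powr
  \<theta> from there to G u.\<close>

definition primitive_const :: "real \<Rightarrow> real \<Rightarrow> real \<Rightarrow> real" where
  "primitive_const \<theta> p q = (1/2) powr \<theta> / 2 powr (2 * \<theta>) * size_const \<theta> p q"

locale small_data_p_system = damped_p_system +
  fixes \<phi> \<psi> :: "real \<Rightarrow> real" and \<epsilon> p q :: real
  assumes u_0: "u 0 x = 1 + \<epsilon> * \<phi> x" and v_0: "v 0 x = \<epsilon> * \<psi> x"
    and \<phi>_bdd: "\<bar>\<phi> x\<bar> \<le> p" and \<psi>_bdd: "\<bar>\<psi> x\<bar> \<le> q" and \<epsilon>: "\<epsilon> > 0"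
    and small1: "\<epsilon> * p \<le> 1/2" and small2: "\<epsilon> * size_const \<theta> p q \<le> 2 powr (2 * \<theta>) / 4"
begin

lemma u_0_range: "u 0 x \<in> {1/2..2}"
proof -
  have "\<bar>\<epsilon> * \<phi> x\<bar> \<le> \<epsilon> * p" using \<epsilon> \<phi>_bdd[of x] by (simp add: abs_mult)
  then show ?thesis using small1 by (auto simp: u_0)
qed

lemma small_amplitude:
  assumes "t \<in> {0..<T}"
  shows "\<bar>v t x\<bar> + \<bar>H (u t x)\<bar> \<le> \<epsilon> * size_const \<theta> p q"
proof (rule amplitude_bound[OF _ assms])
  fix x
  have "\<bar>H (u 0 x)\<bar> \<le> (1/2) powr (2 * \<theta>) * \<bar>u 0 x - 1\<bar>"
    using powr_primitive_bounds(1)[OF u_0_range] theta by simp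
  also have "\<dots> \<le> (1/2) powr (2 * \<theta>) * (\<epsilon> * p)"
    using \<epsilon> \<phi>_bdd[of x] by (intro mult_left_mono) (auto simp: u_0 abs_mult)
  finally have *: "\<bar>H (u 0 x)\<bar> \<le> (1/2) powr (2 * \<theta>) * (\<epsilon> * p)" .
  show "\<bar>v 0 x\<bar> + \<bar>H (u 0 x)\<bar> \<le> \<epsilon> * size_const \<theta> p q"
  proof -
    have "\<bar>v 0 x\<bar> \<le> \<epsilon> * q" using \<epsilon> \<psi>_bdd[of x] by (simp add: v_0 abs_mult)
    with * show ?thesis by (simp add: size_const_def algebra_simps)
  qed
qed

text \<open>No bootstrap: the bound on H u holds before u is known to be near 1, and monotonicity of
  H then confines u.\<close>

lemma u_range:
  assumes t: "t \<in> {0..<T}"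
  shows "u t x \<in> {1/2..2}"
proof -
  let ?m = "2 powr (2 * \<theta>) / 4"
  have m: "?m > 0" by simp
  have H: "\<bar>H (u t x)\<bar> \<le> ?m" using small_amplitude[OF t, of x] small2 by linarith
  \<comment> \<open>The divisor 4 in \<open>small2\<close> is twice what reaching 1/2 would allow,
    which makes the comparison with both end values strict.\<close>
  have "2 * ?m \<le> \<bar>H (1/2)\<bar>" "4 * ?m \<le> \<bar>H 2\<bar>"
    using powr_primitive_bounds(2)[of "1/2" "2 * \<theta>"] powr_primitive_bounds(2)[of 2 "2 * \<theta>"] theta by auto
  moreover have "H (1/2) \<le> 0" "0 \<le> H 2"
    using powr_primitive_mono[of "1/2" 1 "2 * \<theta>"] powr_primitive_mono[of 1 2 "2 * \<theta>"] by auto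
  ultimately have ends: "H (1/2) < - ?m" "?m < H 2" using m by linarith+
  have "\<not> u t x < 1/2" using powr_primitive_mono[OF u_pos[OF t], of x "1/2" "2 * \<theta>"] ends H by auto
  moreover have "\<not> 2 < u t x" using powr_primitive_mono[of 2 "u t x" "2 * \<theta>"] ends H by auto
  ultimately show ?thesis by simp
qed

lemma v_le_1: "t \<in> {0..<T} \<Longrightarrow> \<bar>v t x\<bar> \<le> 1"
proof -
  assume "t \<in> {0..<T}"
  from small_amplitude[OF this, of x] have "\<bar>v t x\<bar> \<le> 2 powr (2 * \<theta>) / 4" using small2 by linarith
  also have "\<dots> \<le> 2 powr 0 / 4" using theta by (intro divide_right_mono powr_mono) auto
  finally show ?thesis by simp
qed

lemma in_X_space:
  assumes t: "t \<in> {0..<T}"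
  shows "(u t, v t) \<in> X_space 3 (1/2)"
proof -
  have "\<bar>u t x\<bar> \<le> 2" for x using u_range[OF t, of x] by auto
  then have "Linf_norm (u t) \<le> ennreal 2"
    unfolding Linf_norm_def by (intro SUP_least ennreal_leI)
  moreover have "Linf_norm (v t) \<le> ennreal 1"
    unfolding Linf_norm_def by (intro SUP_least ennreal_leI v_le_1 t)
  ultimately have "Linf_norm (u t) + Linf_norm (v t) \<le> ennreal 2 + ennreal 1" by (rule add_mono)
  also have "\<dots> = ennreal 3" by (subst ennreal_plus[symmetric]) auto
  finally show ?thesis using in_C1b[OF t] u_range[OF t] by (auto simp: X_space_def)
qed

lemma G_small:
  assumes t: "t \<in> {0..<T}"
  shows "\<bar>G (u t x)\<bar> \<le> \<epsilon> * primitive_const \<theta> p q"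
proof -
  have "2 powr (2 * \<theta>) * \<bar>u t x - 1\<bar> \<le> \<epsilon> * size_const \<theta> p q"
    using powr_primitive_bounds(2)[OF u_range[OF t], of "2 * \<theta>" x] small_amplitude[OF t, of x] theta by simp
  then have "\<bar>u t x - 1\<bar> \<le> \<epsilon> * size_const \<theta> p q / 2 powr (2 * \<theta>)" by (simp add: field_simps)
  then have "(1/2) powr \<theta> * \<bar>u t x - 1\<bar> \<le> (1/2) powr \<theta> * (\<epsilon> * size_const \<theta> p q / 2 powr (2 * \<theta>))"
    by (rule mult_left_mono) simp
  then show ?thesis
    using powr_primitive_bounds(1)[OF u_range[OF t], of \<theta> x] theta by (simp add: primitive_const_def mult_ac)
qed

end

text \<open>Lower bound for the coefficient of the quadratic term while u lies between 1/2 and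
  2.\<close>

definition riccati_const :: "real \<Rightarrow> real" where
  "riccati_const \<theta> = - \<theta> * (1/2) powr (- \<theta>) / 2"

lemma riccati_const_pos: "\<theta> < 0 \<Longrightarrow> riccati_const \<theta> > 0"
  by (simp add: riccati_const_def mult_neg_pos)

text \<open>The initial condition of \<open>riccati_blowup\<close> with g = \<epsilon> *
  primitive_const is linear in \<epsilon>; this is the condition divided by \<epsilon> and by 2 powr
  \<theta>, the least value of the weight on the range of u.\<close>

definition slope_threshold :: "real \<Rightarrow> real \<Rightarrow> real \<Rightarrow> real \<Rightarrow> real \<Rightarrow> real" where
  "slope_threshold \<theta> F1 P1 p q = (1 + primitive_const \<theta> p q * (2 * (F1 + P1) + P1)) / 2 powr \<theta>"

locale weighted_small_data_p_system = small_data_p_system + damping_weights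
begin

text \<open>The family whose slope receives the favourable sign from \<open>u\<^sub>x\<close> is chosen, so no bound on the
  initial \<open>u\<^sub>x\<close> is needed.\<close>

lemma weight_bound:
  assumes steep: "v\<^sub>x 0 z \<le> - \<epsilon> * slope_threshold \<theta> F1 P1 p q" and t: "t \<in> {0..<T}"
  shows "B t \<le> 4 / (riccati_const \<theta> * \<epsilon>)"
proof -
  interpret weighted_p_system by unfold_locales
  define \<sigma> :: real where "\<sigma> = (if u\<^sub>x 0 z \<ge> 0 then 1 else - 1)"
  have nonneg: "0 \<le> \<sigma> * u 0 z powr (2 * \<theta>) * u\<^sub>x 0 z"
    by (auto simp: \<sigma>_def mult_le_0_iff)
  let ?K = "slope_threshold \<theta> F1 P1 p q"
  have p: "p \<ge> 0" and q: "q \<ge> 0" using \<phi>_bdd[of 0] \<psi>_bdd[of 0] by linarith+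
  have "F1 \<ge> 0" "P1 \<ge> 0" using F_bound[of 0] F_0 P_bound[of 0] by auto
  then have K: "?K \<ge> 0" using p q
    by (simp add: slope_threshold_def primitive_const_def size_const_def)
  have "u 0 z powr \<theta> * (v\<^sub>x 0 z - \<sigma> * u 0 z powr (2 * \<theta>) * u\<^sub>x 0 z) \<le> u 0 z powr \<theta> * (- \<epsilon> * ?K)"
    using steep nonneg by (intro mult_left_mono) auto
  also have "\<dots> \<le> - (2 powr \<theta> * (\<epsilon> * ?K))"
  proof -
    have "2 powr \<theta> * (\<epsilon> * ?K) \<le> u 0 z powr \<theta> * (\<epsilon> * ?K)"
      using u_0_range[of z] theta \<epsilon> K by (intro mult_right_mono powr_mono2') auto
    then show ?thesis by simp
  qed
  also have "\<dots> = - \<epsilon> - 2 * (\<epsilon> * primitive_const \<theta> p q) * (F1 + P1) - P1 * (\<epsilon> * primitive_const \<theta> p q)"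
  proof -
    have "2 powr \<theta> * ?K = 1 + primitive_const \<theta> p q * (2 * (F1 + P1) + P1)"
      by (simp add: slope_threshold_def)
    then have "2 powr \<theta> * (\<epsilon> * ?K) = \<epsilon> * (1 + primitive_const \<theta> p q * (2 * (F1 + P1) + P1))"
      by (metis mult.left_commute)
    then show ?thesis by (simp add: algebra_simps)
  qed
  finally show ?thesis
    unfolding riccati_const_def
    using lifespan_weight_bound[OF u_range G_small _ \<epsilon> _ t, of \<sigma> z] by (simp add: \<sigma>_def split: if_splits)
qed

end

section \<open>From bounded solutions to the p-system locale\<close>

lemma has_real_derivative_pressure:
  assumes "w > 0" "\<gamma> \<noteq> 0"
  shows "(pressure \<gamma> has_real_derivative - (w powr (- \<gamma> - 1))) (at w)"
  unfolding pressure_def using assms by (auto intro!: derivative_eq_intros simp: field_simps)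

text \<open>The norm of the pressure derivative is what keeps u away from 0: it bounds u powr (-
  \<gamma> - 1), and a negative power of this bound lies below u.\<close>

lemma bounded_C1_solution_imp_damped_p_system:
  assumes \<gamma>: "\<gamma> > 0" and lam: "lam \<ge> 0" and sol: "bounded_C1_solution \<gamma> \<mu> lam u0 v0 T u v"
  shows "\<exists>l N. damped_p_system (- (\<gamma> + 1) / 4) T l N (\<lambda>t. lam / (1 + t) powr \<mu>) u v (dx u) (dx v)"
proof -
  let ?tot = "\<lambda>t. (Linf_norm (u t) + Linf_norm (v t)) + (Linf_norm (dt u t) + Linf_norm (dt v t))
     + (Linf_norm (dx u t) + Linf_norm (dx v t)) + Linf_norm (\<lambda>x. deriv (pressure \<gamma>) (u t x))"
  have C1: "C1_on_strip T u" "C1_on_strip T v" and u_pos: "\<And>t x. t \<in> {0..<T} \<Longrightarrow> u t x > 0"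
    and mass: "\<And>t x. t \<in> {0..<T} \<Longrightarrow> dt u t x = dx v t x"
    and momentum: "\<And>t x. t \<in> {0..<T} \<Longrightarrow> dt v t x + dx (\<lambda>s y. pressure \<gamma> (u s y)) t x
         = - (lam / (1 + t) powr \<mu>) * v t x"
    and fin: "(SUP t\<in>{0..<T}. ?tot t) < \<infinity>"
    using sol by (auto simp: bounded_C1_solution_def C1_solution_def)
  have t_deriv: "((\<lambda>s. f s x) has_real_derivative dt f t x) (at t within {0..<T})"
    and x_deriv: "(f t has_real_derivative dx f t x) (at x)"
    if "C1_on_strip T f" "t \<in> {0..<T}" for f t x
  proof -
    have "(\<lambda>s. f s x) differentiable (at t within {0..})" "f t differentiable (at x)"
      using that by (auto simp: C1_on_strip_def)
    then show "(f t has_real_derivative dx f t x) (at x)"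
      and "((\<lambda>s. f s x) has_real_derivative dt f t x) (at t within {0..<T})"
      unfolding dx_def dt_def has_real_derivative_iff_has_vector_derivative[of "\<lambda>s. f s x"]
      by (auto simp: DERIV_deriv_iff_real_differentiable vector_derivative_works
          intro: has_vector_derivative_within_subset)
  qed
  define N where "N = enn2real (SUP t\<in>{0..<T}. ?tot t)"
  have N0: "N \<ge> 0" by (simp add: N_def)
  have SN: "(SUP t\<in>{0..<T}. ?tot t) = ennreal N" unfolding N_def using fin by simp
  have norm_le: "\<bar>f x\<bar> \<le> N" if "t \<in> {0..<T}" "Linf_norm f \<le> ?tot t" for f t x
  proof -
    have "ennreal \<bar>f x\<bar> \<le> Linf_norm f" unfolding Linf_norm_def by (rule SUP_upper) simp
    also have "\<dots> \<le> ?tot t" by (rule that)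
    also have "\<dots> \<le> ennreal N" unfolding SN[symmetric] by (rule SUP_upper) (rule that)
    finally show ?thesis using N0 by simp
  qed
  have tot: "Linf_norm (u t) \<le> ?tot t" "Linf_norm (v t) \<le> ?tot t" "Linf_norm (dx u t) \<le> ?tot t"
    "Linf_norm (dx v t) \<le> ?tot t" "Linf_norm (\<lambda>x. deriv (pressure \<gamma>) (u t x)) \<le> ?tot t" for t
    by (simp_all add: add_increasing add_increasing2)
  \<comment> \<open>N + 1 instead of N, since 0 powr anything is 0 and l has to be positive.\<close>
  define l where "l = (N + 1) powr (- 1 / (\<gamma> + 1))"
  show ?thesis
  proof (intro exI, unfold_locales)
    show "- (\<gamma> + 1) / 4 < 0" using \<gamma> by simp
    show "0 < l" using N0 by (simp add: l_def)
    show "continuous_on {0..<T} (\<lambda>t. lam / (1 + t) powr \<mu>)" by (intro continuous_intros) auto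
    show "continuous_on ({0..<T} \<times> UNIV) (\<lambda>(t, x). dx u t x)"
      "continuous_on ({0..<T} \<times> UNIV) (\<lambda>(t, x). dx v t x)"
      using C1 by (auto simp: C1_on_strip_def)
    fix t x assume t: "t \<in> {0..<T}"
    show "0 \<le> lam / (1 + t) powr \<mu>" using lam by simp
    show "((\<lambda>\<tau>. u \<tau> x) has_real_derivative dx v t x) (at t within {0..<T})"
      using t_deriv[OF C1(1) t] mass[OF t] by simp
    have "((\<lambda>y. pressure \<gamma> (u t y)) has_real_derivative - (u t x powr (- \<gamma> - 1)) * dx u t x) (at x)"
      by (rule DERIV_chain2[OF has_real_derivative_pressure x_deriv[OF C1(1) t]]) (use u_pos[OF t] \<gamma> in auto)
    then have "dx (\<lambda>s y. pressure \<gamma> (u s y)) t x = - (u t x powr (- \<gamma> - 1)) * dx u t x"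
      unfolding dx_def by (rule DERIV_imp_deriv)
    then have dt_v: "dt v t x = u t x powr (- \<gamma> - 1) * dx u t x - lam / (1 + t) powr \<mu> * v t x"
      using momentum[OF t, of x] by simp
    have exponent: "4 * (- (\<gamma> + 1) / 4) = - \<gamma> - 1" by simp
    show "((\<lambda>\<tau>. v \<tau> x) has_real_derivative
        u t x powr (4 * (- (\<gamma> + 1) / 4)) * dx u t x - lam / (1 + t) powr \<mu> * v t x) (at t within {0..<T})"
      unfolding exponent using t_deriv[OF C1(2) t, of x] unfolding dt_v .
    show "(u t has_real_derivative dx u t x) (at x)" "(v t has_real_derivative dx v t x) (at x)"
      by (rule x_deriv C1 t)+
    show "u t x \<le> N" using norm_le[OF t tot(1), of x] by simp
    show "\<bar>v t x\<bar> \<le> N" "\<bar>dx u t x\<bar> \<le> N" "\<bar>dx v t x\<bar> \<le> N" by (rule norm_le[OF t] tot)+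
    have "deriv (pressure \<gamma>) (u t x) = - (u t x powr (- \<gamma> - 1))"
      by (rule DERIV_imp_deriv has_real_derivative_pressure u_pos t)+ (use \<gamma> in simp)
    then have "u t x powr (- \<gamma> - 1) \<le> N + 1" using norm_le[OF t tot(5), of x] by simp
    then have "(N + 1) powr (- 1 / (\<gamma> + 1)) \<le> (u t x powr (- \<gamma> - 1)) powr (- 1 / (\<gamma> + 1))"
      using \<gamma> u_pos[OF t, of x] by (intro powr_mono2') auto
    also have "(- \<gamma> - 1) * (- 1 / (\<gamma> + 1)) = 1" using \<gamma> by (simp add: field_simps)
    then have "(u t x powr (- \<gamma> - 1)) powr (- 1 / (\<gamma> + 1)) = u t x"
      using u_pos[OF t, of x] by (simp add: powr_powr)
    finally show "l \<le> u t x" by (simp add: l_def)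
  qed
qed

theorem theorem2p10:
  fixes \<gamma> \<mu> lam :: real
  assumes "\<gamma> > 1"
    and "(\<mu> > 1 \<and> lam \<ge> 0) \<or> (\<mu> = 1 \<and> 0 \<le> lam \<and> lam \<le> 2)"
  shows "\<exists>K :: ennreal \<Rightarrow> ennreal \<Rightarrow> real. (\<forall>a b. K a b > 0) \<and>
    (\<forall>\<phi> \<psi> \<phi>m \<psi>m. \<phi> \<in> C1b \<longrightarrow> \<psi> \<in> C1b \<longrightarrow>
       (\<phi> \<longlongrightarrow> \<phi>m) at_bot \<longrightarrow> (\<psi> \<longlongrightarrow> \<psi>m) at_bot \<longrightarrow>
       (\<exists>x0. deriv \<psi> x0 \<le> - K (Linf_norm \<phi>) (Linf_norm \<psi>)) \<longrightarrow>
       (\<exists>\<epsilon>0>0. \<exists>C>0. \<exists>m>0. \<exists>\<delta>>0. \<forall>\<epsilon>. 0 < \<epsilon> \<and> \<epsilon> \<le> \<epsilon>0 \<longrightarrow>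
          (let u0 = (\<lambda>x. 1 + \<epsilon> * \<phi> x); v0 = (\<lambda>x. \<epsilon> * \<psi> x); Tstar = lifespan \<gamma> \<mu> lam u0 v0 in
             (\<mu> > 1 \<and> lam \<ge> 0 \<longrightarrow> Tstar \<le> ereal (C * \<epsilon> powr (-1))) \<and>
             (\<mu> = 1 \<and> 0 \<le> lam \<and> lam < 2 \<longrightarrow> Tstar \<le> ereal (C * \<epsilon> powr (- (2 / (2 - lam))))) \<and>
             (\<mu> = 1 \<and> lam = 2 \<longrightarrow> Tstar \<le> ereal (exp (C / \<epsilon>))) \<and>
             (\<forall>u v. solution_up_to_lifespan \<gamma> \<mu> lam u0 v0 u v \<longrightarrow>
                (\<forall>t\<ge>0. ereal t < Tstar \<longrightarrow> (u t, v t) \<in> X_space m \<delta>)))))"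
proof -
  define \<theta> where "\<theta> = - (\<gamma> + 1) / 4"
  have \<theta>: "\<theta> < 0" using assms(1) by (simp add: \<theta>_def)
  have lam: "lam \<ge> 0" using assms(2) by auto
  obtain A P P' F F' B B' P1 F1 where
    weights: "damping_weights (\<lambda>t. lam / (1 + t) powr \<mu>) A P P' F F' B B' P1 F1"
    and time: "\<And>c. c > 0 \<Longrightarrow> \<exists>C>0. \<forall>\<epsilon> t. 0 < \<epsilon> \<longrightarrow> \<epsilon> \<le> 1 \<longrightarrow> 0 \<le> t \<longrightarrow> B t \<le> c / \<epsilon>
        \<longrightarrow> t \<le> lifespan_bound \<mu> lam C \<epsilon>"
    using damping_weights_exist[OF assms(2)] by blast
  interpret weights: damping_weights "\<lambda>t. lam / (1 + t) powr \<mu>" A P P' F F' B B' P1 F1 by (rule weights)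
  have PF: "P1 \<ge> 0" "F1 \<ge> 0"
    using weights.P_bound[of 0] weights.F_bound[of 0] weights.F_0 by auto
  obtain C where C: "C > 0" "\<And>\<epsilon> t. 0 < \<epsilon> \<Longrightarrow> \<epsilon> \<le> 1 \<Longrightarrow> 0 \<le> t \<Longrightarrow> B t \<le> 4 / riccati_const \<theta> / \<epsilon>
      \<Longrightarrow> t \<le> lifespan_bound \<mu> lam C \<epsilon>"
    using time[of "4 / riccati_const \<theta>"] riccati_const_pos[OF \<theta>] by auto
  define K where "K a b = slope_threshold \<theta> F1 P1 (enn2real a) (enn2real b)" for a b
  show ?thesis
  proof (intro exI[of _ K] conjI allI impI)
    show "K a b > 0" for a b
      using PF unfolding K_def slope_threshold_def primitive_const_def size_const_def
      by (intro divide_pos_pos add_pos_nonneg mult_nonneg_nonneg add_nonneg_nonneg divide_nonneg_nonneg) auto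
    fix \<phi> \<psi> assume \<phi>: "\<phi> \<in> C1b" and \<psi>: "\<psi> \<in> C1b"
      and "\<exists>x0. deriv \<psi> x0 \<le> - K (Linf_norm \<phi>) (Linf_norm \<psi>)"
    then obtain z where z: "deriv \<psi> z \<le> - K (Linf_norm \<phi>) (Linf_norm \<psi>)" by blast
    define p q where "p = enn2real (Linf_norm \<phi>)" and "q = enn2real (Linf_norm \<psi>)"
    have p: "\<bar>\<phi> x\<bar> \<le> p" and q: "\<bar>\<psi> x\<bar> \<le> q" for x
      using \<phi> \<psi> abs_le_Linf_norm by (auto simp: p_def q_def C1b_def)
    have p0: "p \<ge> 0" and q0: "q \<ge> 0" by (simp_all add: p_def q_def)
    have size: "size_const \<theta> p q \<ge> 0" using p0 q0 by (simp add: size_const_def)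
    \<comment> \<open>The entries give \<epsilon> \<le> 1 for the inversion of B and the two
      smallness conditions; adding 1 in the denominators covers zero norms.\<close>
    define \<epsilon>0 where "\<epsilon>0 = min 1 (min (1 / (2 * (p + 1))) (2 powr (2 * \<theta>) / 4 / (size_const \<theta> p q + 1)))"
    have "\<epsilon>0 > 0" using p0 size by (simp add: \<epsilon>0_def)
    have small: "\<epsilon> \<le> 1" "\<epsilon> * p \<le> 1/2" "\<epsilon> * size_const \<theta> p q \<le> 2 powr (2 * \<theta>) / 4"
      if "0 < \<epsilon>" "\<epsilon> \<le> \<epsilon>0" for \<epsilon>
    proof -
      have *: "\<epsilon> * a \<le> c" if "\<epsilon> \<le> c / (a + 1)" "a \<ge> 0" for a c :: real
      proof -
        have "\<epsilon> * (a + 1) \<le> c" using that by (simp add: pos_le_divide_eq)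
        then show ?thesis using \<open>0 < \<epsilon>\<close> by (simp add: distrib_left)
      qed
      show "\<epsilon> \<le> 1" using that by (simp add: \<epsilon>0_def)
      show "\<epsilon> * p \<le> 1/2" by (rule *) (use that p0 in \<open>simp_all add: \<epsilon>0_def\<close>)
      show "\<epsilon> * size_const \<theta> p q \<le> 2 powr (2 * \<theta>) / 4"
        by (rule *) (use that size in \<open>simp_all add: \<epsilon>0_def\<close>)
    qed
    have system: "\<exists>l N. small_data_p_system \<theta> T l N (\<lambda>t. lam / (1 + t) powr \<mu>) u v (dx u) (dx v) \<phi> \<psi> \<epsilon> p q"
      if \<epsilon>: "0 < \<epsilon>" "\<epsilon> \<le> \<epsilon>0"
        and sol: "bounded_C1_solution \<gamma> \<mu> lam (\<lambda>x. 1 + \<epsilon> * \<phi> x) (\<lambda>x. \<epsilon> * \<psi> x) T u v" for \<epsilon> T u v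
    proof -
      obtain l N where "damped_p_system \<theta> T l N (\<lambda>t. lam / (1 + t) powr \<mu>) u v (dx u) (dx v)"
        using bounded_C1_solution_imp_damped_p_system[OF _ lam sol] assms(1) by (auto simp: \<theta>_def)
      moreover have "u 0 x = 1 + \<epsilon> * \<phi> x" "v 0 x = \<epsilon> * \<psi> x" for x
        using sol by (auto simp: bounded_C1_solution_def C1_solution_def)
      ultimately show ?thesis
        using small[OF \<epsilon>] p q \<epsilon>(1)
        by (intro exI small_data_p_system.intro) (auto simp: small_data_p_system_axioms_def)
    qed
    have bound: "T \<le> lifespan_bound \<mu> lam C \<epsilon>"
      if le: "0 < \<epsilon>" "\<epsilon> \<le> \<epsilon>0" and T: "T > 0"
        and sol: "bounded_C1_solution \<gamma> \<mu> lam (\<lambda>x. 1 + \<epsilon> * \<phi> x) (\<lambda>x. \<epsilon> * \<psi> x) T u v" for \<epsilon> T u v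
    \<comment> \<open>The weight bound is available only at times t < T, where the solution lives; T
      inherits the estimate as their supremum.\<close>
    proof (rule dense_le_bounded[OF T])
      fix t assume t: "0 < t" "t < T"
      obtain l N where "small_data_p_system \<theta> T l N (\<lambda>t. lam / (1 + t) powr \<mu>) u v (dx u) (dx v) \<phi> \<psi> \<epsilon> p q"
        using system[OF le sol] by blast
      then interpret weighted_small_data_p_system \<theta> T l N "\<lambda>t. lam / (1 + t) powr \<mu>" u v "dx u" "dx v"
          \<phi> \<psi> \<epsilon> p q A P P' F F' B B' P1 F1
        using weights by (rule weighted_small_data_p_system.intro)
      have "v 0 = (\<lambda>x. \<epsilon> * \<psi> x)" using v_0 by auto
      moreover have "\<psi> differentiable (at z)"
        using \<psi> by (auto simp: C1b_def C1_differentiable_on_eq)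
      ultimately have "dx v 0 z = \<epsilon> * deriv \<psi> z"
        by (auto simp: dx_def DERIV_deriv_iff_real_differentiable intro!: DERIV_imp_deriv DERIV_cmult)
      also have "\<dots> \<le> \<epsilon> * - slope_threshold \<theta> F1 P1 p q"
        using z le by (intro mult_left_mono) (auto simp: K_def p_def q_def)
      finally have "B t \<le> 4 / (riccati_const \<theta> * \<epsilon>)"
        using t by (intro weight_bound[of z]) auto
      then show "t \<le> lifespan_bound \<mu> lam C \<epsilon>"
        using le small[OF le] t by (intro C) auto
    qed
    show "\<exists>\<epsilon>0>0. \<exists>C>0. \<exists>m>0. \<exists>\<delta>>0. \<forall>\<epsilon>. 0 < \<epsilon> \<and> \<epsilon> \<le> \<epsilon>0 \<longrightarrow>
          (let u0 = (\<lambda>x. 1 + \<epsilon> * \<phi> x); v0 = (\<lambda>x. \<epsilon> * \<psi> x); Tstar = lifespan \<gamma> \<mu> lam u0 v0 in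
             (\<mu> > 1 \<and> lam \<ge> 0 \<longrightarrow> Tstar \<le> ereal (C * \<epsilon> powr (-1))) \<and>
             (\<mu> = 1 \<and> 0 \<le> lam \<and> lam < 2 \<longrightarrow> Tstar \<le> ereal (C * \<epsilon> powr (- (2 / (2 - lam))))) \<and>
             (\<mu> = 1 \<and> lam = 2 \<longrightarrow> Tstar \<le> ereal (exp (C / \<epsilon>))) \<and>
             (\<forall>u v. solution_up_to_lifespan \<gamma> \<mu> lam u0 v0 u v \<longrightarrow>
                (\<forall>t\<ge>0. ereal t < Tstar \<longrightarrow> (u t, v t) \<in> X_space m \<delta>)))"
    proof (rule exI[of _ \<epsilon>0], intro conjI, fact,
        rule exI[of _ C], intro conjI, fact, rule exI[of _ 3], intro conjI, simp,
        rule exI[of _ "1/2"], intro conjI allI impI, simp, elim conjE)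
      fix \<epsilon> assume \<epsilon>: "0 < \<epsilon>" "\<epsilon> \<le> \<epsilon>0"
      let ?u0 = "\<lambda>x. 1 + \<epsilon> * \<phi> x" and ?v0 = "\<lambda>x. \<epsilon> * \<psi> x"
      have "lifespan \<gamma> \<mu> lam ?u0 ?v0 \<le> ereal (lifespan_bound \<mu> lam C \<epsilon>)"
        unfolding lifespan_def by (rule Sup_least) (use bound[OF \<epsilon>] in auto)
      moreover have "(u t, v t) \<in> X_space 3 (1/2)"
        if sol: "solution_up_to_lifespan \<gamma> \<mu> lam ?u0 ?v0 u v" and t: "0 \<le> t" "ereal t < lifespan \<gamma> \<mu> lam ?u0 ?v0" for u v t
      proof -
        \<comment> \<open>An intermediate T is needed because a solution on [0, T) must contain t in
          its half-open interval.\<close>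
        obtain T where T: "ereal t < ereal T" "ereal T < lifespan \<gamma> \<mu> lam ?u0 ?v0"
          using ereal_dense2[OF t(2)] by blast
        then have "bounded_C1_solution \<gamma> \<mu> lam ?u0 ?v0 T u v"
          using sol t(1) by (auto simp: solution_up_to_lifespan_def)
        from system[OF \<epsilon> this] obtain l N where
          "small_data_p_system \<theta> T l N (\<lambda>t. lam / (1 + t) powr \<mu>) u v (dx u) (dx v) \<phi> \<psi> \<epsilon> p q" by blast
        then show ?thesis by (rule small_data_p_system.in_X_space) (use t T in auto)
      qed
      ultimately show "let u0 = ?u0; v0 = ?v0; Tstar = lifespan \<gamma> \<mu> lam u0 v0 in
             (\<mu> > 1 \<and> lam \<ge> 0 \<longrightarrow> Tstar \<le> ereal (C * \<epsilon> powr (-1))) \<and>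
             (\<mu> = 1 \<and> 0 \<le> lam \<and> lam < 2 \<longrightarrow> Tstar \<le> ereal (C * \<epsilon> powr (- (2 / (2 - lam))))) \<and>
             (\<mu> = 1 \<and> lam = 2 \<longrightarrow> Tstar \<le> ereal (exp (C / \<epsilon>))) \<and>
             (\<forall>u v. solution_up_to_lifespan \<gamma> \<mu> lam u0 v0 u v \<longrightarrow>
                (\<forall>t\<ge>0. ereal t < Tstar \<longrightarrow> (u t, v t) \<in> X_space 3 (1/2)))"
        by (auto simp: Let_def lifespan_bound_def)
    qed
  qed
qed

end
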